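(* The monomorphisms $F_n:W(\tilde C_n)\to W(\tilde C_{n+1})$ ($n\ge 2$) and $L_n:W(\tilde B_n)\to W(\tilde B_{n+1})$ ($n\ge 3$) defined in the context satisfy, for all $v\in W(\tilde C_n)$ and all $w\in W(\tilde B_n)$: $$l(F_n(v))=l(v)+2L(v),\qquad L(F_n(v))=L(v),$$ $$l(L_n(w))=l(w)+2L(w),\qquad L(L_n(w))=L(w).$$
   Context: For $m\ge 2$, $W(\tilde C_m)$ is the Coxeter group with generators $\sigma_0,\sigma_1,\dots,\sigma_{m-1},t_m$, where $\sigma_0\sigma_1$ has order 4, $\sigma_i\sigma_{i+1}$ has order 3 for $1\le i\le m-2$, $\sigma_{m-1}t_m$ has order 4, and all other pairs of distinct generators commute. For $m\ge 3$, $W(\tilde B_m)$ is the Coxeter group with generators $\sigma_1,\sigma_{\bar 1},\sigma_2,\dots,\sigma_{m-1},t_m$, where $\sigma_i\sigma_{i+1}$ has order 3 for $1\le i\le m-2$, $\sigma_{\bar 1}\sigma_2$ has order 3, $\sigma_{m-1}t_m$ has order 4, and all other pairs of distinct generators commute. $F_n$ and $L_n$ are the (injective) group homomorphisms that send every generator other than $t_n$ to the generator with the same name and send $t_n$ to $\sigma_n t_{n+1}\sigma_n$. $l$ denotes Coxeter length. For $w\in W(\tilde B_m)$ or $W(\tilde C_m)$, the affine length $L(w)$ (an integer, not to be confused with the homomorphism $L_n$) is the number of occurrences of $t_m$ in a reduced expression of $w$; it does not depend on the reduced expression. *)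

theory Defs
  imports "HOL-Algebra.Group"
begin

section \<open>Coxeter groups\<close>

text \<open>
  A Coxeter system is given by a set \<open>S\<close> of generators and a matrix \<open>M\<close> of exponents.
  Since the diagonal relations \<open>(s s) ^ M s s = 1\<close> with \<open>M s s = 1\<close> make every generator its own
  inverse, the group presented by the relations \<open>(s t) ^ M s t = 1\<close> is the set of words
  in the letters \<open>S\<close> (without formal inverses) modulo the congruence generated by the relations.
  That this is indeed the presented group is confirmed below: it is a group
  (\<open>group_coxeter_group\<close>) and it has the universal property (\<open>coxeter_lift_exists1\<close>).
\<close>

inductive coxeter_eq :: "'s set \<Rightarrow> ('s \<Rightarrow> 's \<Rightarrow> nat) \<Rightarrow> 's list \<Rightarrow> 's list \<Rightarrow> bool"
  for S :: "'s set" and M :: "'s \<Rightarrow> 's \<Rightarrow> nat" where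
  rel: "s \<in> S \<Longrightarrow> t \<in> S \<Longrightarrow> coxeter_eq S M (concat (replicate (M s t) [s, t])) []"
| refl: "w \<in> lists S \<Longrightarrow> coxeter_eq S M w w"
| sym: "coxeter_eq S M u v \<Longrightarrow> coxeter_eq S M v u"
| trans: "coxeter_eq S M u v \<Longrightarrow> coxeter_eq S M v w \<Longrightarrow> coxeter_eq S M u w"
| append: "coxeter_eq S M u u' \<Longrightarrow> coxeter_eq S M v v' \<Longrightarrow> coxeter_eq S M (u @ v) (u' @ v')"

definition coxeter_rel :: "'s set \<Rightarrow> ('s \<Rightarrow> 's \<Rightarrow> nat) \<Rightarrow> ('s list \<times> 's list) set" where
  "coxeter_rel S M = {(u, v). coxeter_eq S M u v}"

definition coxeter_elt :: "'s set \<Rightarrow> ('s \<Rightarrow> 's \<Rightarrow> nat) \<Rightarrow> 's list \<Rightarrow> 's list set" where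
  "coxeter_elt S M w = coxeter_rel S M `` {w}"

definition coxeter_group :: "'s set \<Rightarrow> ('s \<Rightarrow> 's \<Rightarrow> nat) \<Rightarrow> 's list set monoid" where
  "coxeter_group S M =
     \<lparr>carrier = lists S // coxeter_rel S M,
      mult = (\<lambda>X Y. \<Union>u\<in>X. \<Union>v\<in>Y. coxeter_elt S M (u @ v)),
      one = coxeter_elt S M []\<rparr>"

abbreviation coxeter_gen :: "'s set \<Rightarrow> ('s \<Rightarrow> 's \<Rightarrow> nat) \<Rightarrow> 's \<Rightarrow> 's list set" where
  "coxeter_gen S M s \<equiv> coxeter_elt S M [s]"

text \<open>
  A word is an expression of \<open>x\<close> if the product of its letters is \<open>x\<close>.
\<close>

definition expression :: "'s set \<Rightarrow> ('s \<Rightarrow> 's \<Rightarrow> nat) \<Rightarrow> 's list set \<Rightarrow> 's list \<Rightarrow> bool" where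
  "expression S M x w \<longleftrightarrow> w \<in> lists S \<and>
     foldr (\<lambda>s y. coxeter_gen S M s \<otimes>\<^bsub>coxeter_group S M\<^esub> y) w \<one>\<^bsub>coxeter_group S M\<^esub> = x"

definition coxeter_length :: "'s set \<Rightarrow> ('s \<Rightarrow> 's \<Rightarrow> nat) \<Rightarrow> 's list set \<Rightarrow> nat" where
  "coxeter_length S M x = (LEAST k. \<exists>w. expression S M x w \<and> length w = k)"

definition reduced_expression :: "'s set \<Rightarrow> ('s \<Rightarrow> 's \<Rightarrow> nat) \<Rightarrow> 's list set \<Rightarrow> 's list \<Rightarrow> bool" where
  "reduced_expression S M x w \<longleftrightarrow> expression S M x w \<and> length w = coxeter_length S M x"

text \<open>
  The number of occurrences of the generator \<open>t\<close> in a reduced expression of \<open>x\<close>. It is only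
  meaningful where this number does not depend on the reduced expression, as is the case for the
  generators \<open>Tm m\<close> of the two families below.
\<close>

definition occurrences :: "'s set \<Rightarrow> ('s \<Rightarrow> 's \<Rightarrow> nat) \<Rightarrow> 's \<Rightarrow> 's list set \<Rightarrow> nat" where
  "occurrences S M t x = (THE k. \<exists>w. reduced_expression S M x w \<and> count_list w t = k)"

text \<open>
  The group homomorphism into \<open>H\<close> that sends each generator \<open>s\<close> to \<open>f s\<close>. It exists and is unique
  if the \<open>f s\<close> satisfy the Coxeter relations.
\<close>

definition coxeter_lift ::
    "'s set \<Rightarrow> ('s \<Rightarrow> 's \<Rightarrow> nat) \<Rightarrow> ('b, 'c) monoid_scheme \<Rightarrow> ('s \<Rightarrow> 'b) \<Rightarrow> 's list set \<Rightarrow> 'b" where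
  "coxeter_lift S M H f =
     (THE g. g \<in> hom (coxeter_group S M) H \<and> g \<in> extensional (carrier (coxeter_group S M)) \<and>
             (\<forall>s\<in>S. g (coxeter_gen S M s) = f s))"


section \<open>The affine families B and C\<close>

text \<open>
  \<open>Sig i\<close>, \<open>Sigbar\<close> and \<open>Tm m\<close> are the generators named $\sigma_i$, $\sigma_{\bar 1}$ and $t_m$.
\<close>

datatype generator = Sig nat | Sigbar | Tm nat

definition gens_C :: "nat \<Rightarrow> generator set" where
  "gens_C m = Sig ` {0..m - 1} \<union> {Tm m}"

definition matrix_C :: "nat \<Rightarrow> generator \<Rightarrow> generator \<Rightarrow> nat" where
  "matrix_C m s t =
     (if s = t then 1
      else if {s, t} = {Sig 0, Sig 1} then 4
      else if \<exists>i\<in>{1..m - 2}. {s, t} = {Sig i, Sig (i + 1)} then 3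
      else if {s, t} = {Sig (m - 1), Tm m} then 4
      else 2)"

definition gens_B :: "nat \<Rightarrow> generator set" where
  "gens_B m = Sig ` {1..m - 1} \<union> {Sigbar, Tm m}"

definition matrix_B :: "nat \<Rightarrow> generator \<Rightarrow> generator \<Rightarrow> nat" where
  "matrix_B m s t =
     (if s = t then 1
      else if \<exists>i\<in>{1..m - 2}. {s, t} = {Sig i, Sig (i + 1)} then 3
      else if {s, t} = {Sigbar, Sig 2} then 3
      else if {s, t} = {Sig (m - 1), Tm m} then 4
      else 2)"

definition W_C :: "nat \<Rightarrow> generator list set monoid" where
  "W_C m = coxeter_group (gens_C m) (matrix_C m)"

definition W_B :: "nat \<Rightarrow> generator list set monoid" where
  "W_B m = coxeter_group (gens_B m) (matrix_B m)"

definition gen_C :: "nat \<Rightarrow> generator \<Rightarrow> generator list set" where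
  "gen_C m s = coxeter_gen (gens_C m) (matrix_C m) s"

definition gen_B :: "nat \<Rightarrow> generator \<Rightarrow> generator list set" where
  "gen_B m s = coxeter_gen (gens_B m) (matrix_B m) s"

definition length_C :: "nat \<Rightarrow> generator list set \<Rightarrow> nat" where
  "length_C m = coxeter_length (gens_C m) (matrix_C m)"

definition length_B :: "nat \<Rightarrow> generator list set \<Rightarrow> nat" where
  "length_B m = coxeter_length (gens_B m) (matrix_B m)"

definition affine_length_C :: "nat \<Rightarrow> generator list set \<Rightarrow> nat" where
  "affine_length_C m = occurrences (gens_C m) (matrix_C m) (Tm m)"

definition affine_length_B :: "nat \<Rightarrow> generator list set \<Rightarrow> nat" where
  "affine_length_B m = occurrences (gens_B m) (matrix_B m) (Tm m)"

definition images_F :: "nat \<Rightarrow> generator \<Rightarrow> generator list set" where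
  "images_F n s =
     (if s = Tm n
      then gen_C (n + 1) (Sig n) \<otimes>\<^bsub>W_C (n + 1)\<^esub> gen_C (n + 1) (Tm (n + 1))
             \<otimes>\<^bsub>W_C (n + 1)\<^esub> gen_C (n + 1) (Sig n)
      else gen_C (n + 1) s)"

definition images_L :: "nat \<Rightarrow> generator \<Rightarrow> generator list set" where
  "images_L n s =
     (if s = Tm n
      then gen_B (n + 1) (Sig n) \<otimes>\<^bsub>W_B (n + 1)\<^esub> gen_B (n + 1) (Tm (n + 1))
             \<otimes>\<^bsub>W_B (n + 1)\<^esub> gen_B (n + 1) (Sig n)
      else gen_B (n + 1) s)"

definition F_hom :: "nat \<Rightarrow> generator list set \<Rightarrow> generator list set" where
  "F_hom n = coxeter_lift (gens_C n) (matrix_C n) (W_C (n + 1)) (images_F n)"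

definition L_hom :: "nat \<Rightarrow> generator list set \<Rightarrow> generator list set" where
  "L_hom n = coxeter_lift (gens_B n) (matrix_B n) (W_B (n + 1)) (images_L n)"


section \<open>Well-definedness\<close>

lemma coxeter_eq_lists: "coxeter_eq S M u v \<Longrightarrow> u \<in> lists S \<and> v \<in> lists S"
  by (induction rule: coxeter_eq.induct) (auto simp: in_lists_conv_set split: if_splits)

lemma equiv_coxeter_rel: "equiv (lists S) (coxeter_rel S M)"
  unfolding coxeter_rel_def
  by (rule equivI)
     (auto simp: refl_on_def sym_def trans_def
           intro: coxeter_eq.refl coxeter_eq.sym coxeter_eq.trans dest: coxeter_eq_lists)

lemma coxeter_elt_eq_iff:
  assumes "u \<in> lists S" "v \<in> lists S"
  shows "coxeter_elt S M u = coxeter_elt S M v \<longleftrightarrow> coxeter_eq S M u v"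
  using eq_equiv_class_iff[OF equiv_coxeter_rel assms]
  by (simp add: coxeter_elt_def coxeter_rel_def)

lemma carrier_coxeter_group: "carrier (coxeter_group S M) = coxeter_elt S M ` lists S"
  by (auto simp: coxeter_group_def coxeter_elt_def quotient_def)

lemma coxeter_elt_closed [simp]:
  "w \<in> lists S \<Longrightarrow> coxeter_elt S M w \<in> carrier (coxeter_group S M)"
  by (simp add: carrier_coxeter_group)

lemma one_coxeter_group: "\<one>\<^bsub>coxeter_group S M\<^esub> = coxeter_elt S M []"
  by (simp add: coxeter_group_def)

lemma mult_coxeter_elt:
  assumes "u \<in> lists S" "v \<in> lists S"
  shows "coxeter_elt S M u \<otimes>\<^bsub>coxeter_group S M\<^esub> coxeter_elt S M v = coxeter_elt S M (u @ v)"
proof -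
  have "coxeter_elt S M (u' @ v') = coxeter_elt S M (u @ v)"
    if "u' \<in> coxeter_elt S M u" "v' \<in> coxeter_elt S M v" for u' v'
  proof -
    have "coxeter_eq S M u u'" "coxeter_eq S M v v'"
      using that by (auto simp: coxeter_elt_def coxeter_rel_def)
    then have "coxeter_eq S M (u @ v) (u' @ v')" by (rule coxeter_eq.append)
    then show ?thesis
      using coxeter_elt_eq_iff coxeter_eq_lists by metis
  qed
  moreover have "u \<in> coxeter_elt S M u" "v \<in> coxeter_elt S M v"
    using assms by (auto simp: coxeter_elt_def coxeter_rel_def intro: coxeter_eq.refl)
  ultimately have "(\<Union>u'\<in>coxeter_elt S M u. \<Union>v'\<in>coxeter_elt S M v. coxeter_elt S M (u' @ v'))
      = coxeter_elt S M (u @ v)"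
    by blast
  then show ?thesis by (simp add: coxeter_group_def)
qed

lemma monoid_coxeter_group: "monoid (coxeter_group S M)"
proof -
  have elt: "\<exists>w\<in>lists S. x = coxeter_elt S M w" if "x \<in> carrier (coxeter_group S M)" for x
    using that unfolding carrier_coxeter_group by blast
  have app: "u @ v \<in> lists S" if "u \<in> lists S" "v \<in> lists S" for u v
    using that by auto
  show ?thesis
  proof (rule monoidI)
    fix x y assume "x \<in> carrier (coxeter_group S M)" "y \<in> carrier (coxeter_group S M)"
    then show "x \<otimes>\<^bsub>coxeter_group S M\<^esub> y \<in> carrier (coxeter_group S M)"
      using elt app mult_coxeter_elt coxeter_elt_closed by metis
  next
    show "\<one>\<^bsub>coxeter_group S M\<^esub> \<in> carrier (coxeter_group S M)"
      by (simp add: one_coxeter_group)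
  next
    fix x y z assume "x \<in> carrier (coxeter_group S M)" "y \<in> carrier (coxeter_group S M)"
      "z \<in> carrier (coxeter_group S M)"
    then obtain u v w where "u \<in> lists S" "x = coxeter_elt S M u" "v \<in> lists S"
      "y = coxeter_elt S M v" "w \<in> lists S" "z = coxeter_elt S M w"
      using elt by metis
    then show "x \<otimes>\<^bsub>coxeter_group S M\<^esub> y \<otimes>\<^bsub>coxeter_group S M\<^esub> z =
        x \<otimes>\<^bsub>coxeter_group S M\<^esub> (y \<otimes>\<^bsub>coxeter_group S M\<^esub> z)"
      using app mult_coxeter_elt append_assoc by metis
  next
    fix x assume "x \<in> carrier (coxeter_group S M)"
    then obtain u where u: "u \<in> lists S" "x = coxeter_elt S M u"
      using elt by metis
    show "\<one>\<^bsub>coxeter_group S M\<^esub> \<otimes>\<^bsub>coxeter_group S M\<^esub> x = x"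
      using mult_coxeter_elt[of "[]" S u M] u by (simp add: one_coxeter_group)
    show "x \<otimes>\<^bsub>coxeter_group S M\<^esub> \<one>\<^bsub>coxeter_group S M\<^esub> = x"
      using mult_coxeter_elt[of u S "[]" M] u by (simp add: one_coxeter_group)
  qed
qed

lemma coxeter_eq_rev:
  assumes diag: "\<And>s. s \<in> S \<Longrightarrow> M s s = 1" and "w \<in> lists S"
  shows "coxeter_eq S M (rev w @ w) []"
  using assms(2)
proof (induction w)
  case Nil
  then show ?case by (auto intro: coxeter_eq.refl)
next
  case (Cons a w)
  have r: "coxeter_eq S M (rev w) (rev w)" "coxeter_eq S M w w"
    using Cons by (auto intro!: coxeter_eq.refl)
  have "coxeter_eq S M [a, a] []"
    using coxeter_eq.rel[of a S a M] Cons diag[of a] by simp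
  from coxeter_eq.append[OF coxeter_eq.append[OF r(1) this] r(2)] Cons.IH
  show ?case by (auto intro: coxeter_eq.trans)
qed

lemma group_coxeter_group:
  assumes diag: "\<And>s. s \<in> S \<Longrightarrow> M s s = 1"
  shows "group (coxeter_group S M)"
proof -
  interpret monoid "coxeter_group S M" by (rule monoid_coxeter_group)
  show ?thesis
  proof (rule groupI)
    fix x assume "x \<in> carrier (coxeter_group S M)"
    then obtain w where w: "w \<in> lists S" "x = coxeter_elt S M w"
      by (auto simp: carrier_coxeter_group)
    have r: "rev w \<in> lists S" using w(1) by auto
    have "coxeter_elt S M (rev w) \<otimes>\<^bsub>coxeter_group S M\<^esub> x = coxeter_elt S M (rev w @ w)"
      using mult_coxeter_elt[OF r w(1)] w(2) by simp
    also have "\<dots> = \<one>\<^bsub>coxeter_group S M\<^esub>"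
      unfolding one_coxeter_group
      by (subst coxeter_elt_eq_iff) (use w(1) coxeter_eq_rev[of S M w] diag in auto)
    finally show "\<exists>y\<in>carrier (coxeter_group S M). y \<otimes>\<^bsub>coxeter_group S M\<^esub> x = \<one>\<^bsub>coxeter_group S M\<^esub>"
      using coxeter_elt_closed[OF r] by blast
  qed (auto simp: m_assoc)
qed

lemma foldr_coxeter_gen:
  "w \<in> lists S \<Longrightarrow>
   foldr (\<lambda>s y. coxeter_gen S M s \<otimes>\<^bsub>coxeter_group S M\<^esub> y) w \<one>\<^bsub>coxeter_group S M\<^esub> = coxeter_elt S M w"
proof (induction w)
  case (Cons a w)
  then show ?case using mult_coxeter_elt[of "[a]" S w M] by simp
qed (simp add: one_coxeter_group)

lemma expression_iff: "expression S M x w \<longleftrightarrow> w \<in> lists S \<and> coxeter_elt S M w = x"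
  unfolding expression_def using foldr_coxeter_gen by metis

lemma (in group) foldr_append:
  assumes "f \<in> S \<rightarrow> carrier G" "u \<in> lists S" "v \<in> lists S"
  shows "foldr (\<lambda>s y. f s \<otimes> y) (u @ v) \<one> = foldr (\<lambda>s y. f s \<otimes> y) u \<one> \<otimes> foldr (\<lambda>s y. f s \<otimes> y) v \<one>
    \<and> foldr (\<lambda>s y. f s \<otimes> y) u \<one> \<in> carrier G"
proof -
  have c: "foldr (\<lambda>s y. f s \<otimes> y) w \<one> \<in> carrier G" if "w \<in> lists S" for w
    using that assms(1) by (induction w) auto
  show ?thesis using assms(2)
    using c[OF assms(3)] c assms(1)
    by (induction u) (auto simp: m_assoc Pi_iff in_lists_conv_set)
qed

lemma (in group) foldr_power:
  assumes "a \<in> carrier G" "f s \<in> carrier G" "f t \<in> carrier G"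
  shows "foldr (\<lambda>s y. f s \<otimes> y) (concat (replicate k [s, t])) \<one> = (f s \<otimes> f t) [^] k"
proof (induction k)
  case (Suc k)
  have "(f s \<otimes> f t) [^] Suc k = (f s \<otimes> f t) \<otimes> (f s \<otimes> f t) [^] k"
    using assms by (intro nat_pow_Suc2) auto
  with Suc show ?case using assms by (simp add: m_assoc)
qed simp

lemma coxeter_lift_exists1:
  assumes "group H" and f: "f \<in> S \<rightarrow> carrier H"
    and rels: "\<And>s t. s \<in> S \<Longrightarrow> t \<in> S \<Longrightarrow> (f s \<otimes>\<^bsub>H\<^esub> f t) [^]\<^bsub>H\<^esub> M s t = \<one>\<^bsub>H\<^esub>"
  shows "\<exists>!g. g \<in> hom (coxeter_group S M) H \<and> g \<in> extensional (carrier (coxeter_group S M)) \<and>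
             (\<forall>s\<in>S. g (coxeter_gen S M s) = f s)"
proof -
  interpret H: group H by fact
  define ev where "ev w = foldr (\<lambda>s y. f s \<otimes>\<^bsub>H\<^esub> y) w \<one>\<^bsub>H\<^esub>" for w
  have ev_app: "ev (u @ v) = ev u \<otimes>\<^bsub>H\<^esub> ev v" if "u \<in> lists S" "v \<in> lists S" for u v
    using H.foldr_append[OF f that] by (simp add: ev_def)
  have ev_closed: "ev u \<in> carrier H" if "u \<in> lists S" for u
    using H.foldr_append[OF f that] by (auto simp: ev_def)
  have ev_eq: "ev u = ev v" if "coxeter_eq S M u v" for u v
    using that
  proof (induction rule: coxeter_eq.induct)
    case (rel s t)
    then have "f s \<in> carrier H" "f t \<in> carrier H" using f by auto
    then show ?case
      using H.foldr_power[of "f s" f s t "M s t"] rels[OF rel] by (simp add: ev_def)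
  next
    case (append u u' v v')
    then show ?case by (metis ev_app coxeter_eq_lists)
  qed auto
  define g where "g = (\<lambda>x\<in>carrier (coxeter_group S M). ev (SOME w. w \<in> lists S \<and> coxeter_elt S M w = x))"
  have g: "g (coxeter_elt S M w) = ev w" if w: "w \<in> lists S" for w
  proof -
    define v where "v = (SOME v. v \<in> lists S \<and> coxeter_elt S M v = coxeter_elt S M w)"
    have "v \<in> lists S \<and> coxeter_elt S M v = coxeter_elt S M w"
      unfolding v_def by (rule someI[of _ w]) (use w in simp)
    then have "ev v = ev w" using w ev_eq coxeter_elt_eq_iff by metis
    then show ?thesis
      using coxeter_elt_closed[OF w] by (simp add: g_def flip: v_def)
  qed
  show ?thesis
  proof (rule ex1I[of _ g])
    have "g (coxeter_gen S M s) = f s" if "s \<in> S" for s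
      using that funcset_mem[OF f that] g[of "[s]"] by (simp add: ev_def)
    moreover have "g \<in> hom (coxeter_group S M) H"
    proof (rule homI)
      fix x assume "x \<in> carrier (coxeter_group S M)"
      then obtain u where "u \<in> lists S" "x = coxeter_elt S M u"
        unfolding carrier_coxeter_group by blast
      then show "g x \<in> carrier H" using g ev_closed by simp
    next
      fix x y assume "x \<in> carrier (coxeter_group S M)" "y \<in> carrier (coxeter_group S M)"
      then obtain u v where uv: "u \<in> lists S" "x = coxeter_elt S M u"
        "v \<in> lists S" "y = coxeter_elt S M v"
        unfolding carrier_coxeter_group by blast
      have "u @ v \<in> lists S" using uv by auto
      then show "g (x \<otimes>\<^bsub>coxeter_group S M\<^esub> y) = g x \<otimes>\<^bsub>H\<^esub> g y"
        using uv g ev_app mult_coxeter_elt by metis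
    qed
    ultimately show "g \<in> hom (coxeter_group S M) H \<and>
        g \<in> extensional (carrier (coxeter_group S M)) \<and>
        (\<forall>s\<in>S. g (coxeter_gen S M s) = f s)"
      by (simp add: g_def)
  next
    fix h assume h: "h \<in> hom (coxeter_group S M) H \<and>
        h \<in> extensional (carrier (coxeter_group S M)) \<and>
        (\<forall>s\<in>S. h (coxeter_gen S M s) = f s)"
    have one: "h (coxeter_elt S M []) = \<one>\<^bsub>H\<^esub>"
    proof -
      have e: "coxeter_elt S M [] \<in> carrier (coxeter_group S M)" by simp
      then have c: "h (coxeter_elt S M []) \<in> carrier H" using h by (auto simp: hom_def)
      have "h (coxeter_elt S M []) \<otimes>\<^bsub>H\<^esub> h (coxeter_elt S M []) = h (coxeter_elt S M [])"
        using hom_mult[OF _ e e, of h H] h mult_coxeter_elt[of "[]" S "[]" M] by simp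
      then show ?thesis using c by simp
    qed
    have he: "h (coxeter_elt S M w) = ev w" if "w \<in> lists S" for w
      using that
    proof (induction w)
      case Nil
      show ?case using one by (simp add: ev_def)
    next
      case (Cons a w)
      then have "coxeter_gen S M a \<otimes>\<^bsub>coxeter_group S M\<^esub> coxeter_elt S M w = coxeter_elt S M (a # w)"
        using mult_coxeter_elt[of "[a]" S w M] by simp
      moreover have "coxeter_gen S M a \<in> carrier (coxeter_group S M)"
        "coxeter_elt S M w \<in> carrier (coxeter_group S M)"
        using Cons by simp_all
      ultimately have "h (coxeter_elt S M (a # w)) =
          h (coxeter_gen S M a) \<otimes>\<^bsub>H\<^esub> h (coxeter_elt S M w)"
        using h hom_mult by metis
      then show ?case using Cons h by (simp add: ev_def)
    qed
    show "h = g"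
    proof (rule extensionalityI[of _ "carrier (coxeter_group S M)"])
      show "h \<in> extensional (carrier (coxeter_group S M))" using h by blast
      show "g \<in> extensional (carrier (coxeter_group S M))" by (simp add: g_def)
      fix x assume "x \<in> carrier (coxeter_group S M)"
      then obtain u where "u \<in> lists S" "x = coxeter_elt S M u"
        unfolding carrier_coxeter_group by blast
      then show "h x = g x" using he g by simp
    qed
  qed
qed

lemma coxeter_lift:
  assumes "group H" and "f \<in> S \<rightarrow> carrier H"
    and "\<And>s t. s \<in> S \<Longrightarrow> t \<in> S \<Longrightarrow> (f s \<otimes>\<^bsub>H\<^esub> f t) [^]\<^bsub>H\<^esub> M s t = \<one>\<^bsub>H\<^esub>"
  shows "coxeter_lift S M H f \<in> hom (coxeter_group S M) H"
    and "\<And>s. s \<in> S \<Longrightarrow> coxeter_lift S M H f (coxeter_gen S M s) = f s"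
  using theI'[OF coxeter_lift_exists1[OF assms]] unfolding coxeter_lift_def by blast+

lemma coxeter_gen_rel:
  assumes diag: "\<And>s. s \<in> S \<Longrightarrow> M s s = 1" and st: "s \<in> S" "t \<in> S"
  shows "(coxeter_gen S M s \<otimes>\<^bsub>coxeter_group S M\<^esub> coxeter_gen S M t) [^]\<^bsub>coxeter_group S M\<^esub> M s t
    = \<one>\<^bsub>coxeter_group S M\<^esub>"
proof -
  interpret group "coxeter_group S M" using group_coxeter_group diag by blast
  have l: "concat (replicate (M s t) [s, t]) \<in> lists S" using st by (auto simp: in_lists_conv_set)
  have "(coxeter_gen S M s \<otimes>\<^bsub>coxeter_group S M\<^esub> coxeter_gen S M t) [^]\<^bsub>coxeter_group S M\<^esub> M s t
    = coxeter_elt S M (concat (replicate (M s t) [s, t]))"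
    using foldr_power[of "coxeter_gen S M s" "coxeter_gen S M" s t "M s t"]
      foldr_coxeter_gen[OF l] st by simp
  also have "\<dots> = \<one>\<^bsub>coxeter_group S M\<^esub>"
    unfolding one_coxeter_group
    by (subst coxeter_elt_eq_iff[OF l]) (use st in \<open>auto intro: coxeter_eq.rel\<close>)
  finally show ?thesis .
qed

context group
begin

lemma inv_involution: "a \<in> carrier G \<Longrightarrow> a \<otimes> a = \<one> \<Longrightarrow> inv a = a"
  by (rule inv_equality)

lemma conj_pow:
  assumes "c \<in> carrier G" "x \<in> carrier G"
  shows "(c \<otimes> x \<otimes> inv c) [^] (k::nat) = c \<otimes> x [^] k \<otimes> inv c"
proof (induction k)
  case (Suc k)
  have "c \<otimes> x [^] k \<otimes> inv c \<otimes> (c \<otimes> x \<otimes> inv c) = c \<otimes> x [^] k \<otimes> (inv c \<otimes> c) \<otimes> x \<otimes> inv c"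
    using assms by (simp only: m_assoc nat_pow_closed m_closed inv_closed)
  then show ?case using assms Suc by (simp add: m_assoc)
qed (use assms in simp)

lemma pow_swap:
  assumes "x \<in> carrier G" "y \<in> carrier G" "(x \<otimes> y) [^] (k::nat) = \<one>"
  shows "(y \<otimes> x) [^] k = \<one>"
proof -
  have "y \<otimes> x = y \<otimes> (x \<otimes> y) \<otimes> inv y" using assms by (simp add: m_assoc)
  then show ?thesis using conj_pow[of y "x \<otimes> y" k] assms by simp
qed

lemma commute_of_rel:
  assumes "a \<in> carrier G" "b \<in> carrier G" "a \<otimes> a = \<one>" "b \<otimes> b = \<one>" "(a \<otimes> b) [^] (2::nat) = \<one>"
  shows "a \<otimes> b = b \<otimes> a"
proof -
  have "(a \<otimes> b) \<otimes> (a \<otimes> b) = \<one>" using assms by (simp add: numeral_2_eq_2)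
  then have "inv (a \<otimes> b) = a \<otimes> b" using assms by (intro inv_equality) auto
  then show ?thesis using assms inv_involution by (simp add: inv_mult_group)
qed

lemma braid_of_rel:
  assumes c: "a \<in> carrier G" "b \<in> carrier G"
    and r: "a \<otimes> a = \<one>" "b \<otimes> b = \<one>" "(a \<otimes> b) [^] (3::nat) = \<one>"
  shows "a \<otimes> (b \<otimes> a) = b \<otimes> (a \<otimes> b)"
proof -
  have "(a \<otimes> (b \<otimes> a)) \<otimes> (b \<otimes> (a \<otimes> b)) = \<one>"
    using assms by (simp add: numeral_3_eq_3 m_assoc)
  then have "a \<otimes> (b \<otimes> a) = inv (b \<otimes> (a \<otimes> b))"
    using c by (intro inv_equality[symmetric]) auto
  then show ?thesis using c r inv_involution by (simp add: inv_mult_group m_assoc)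
qed

lemma twisted_involution:
  assumes c: "b \<in> carrier G" "t \<in> carrier G" and r: "b \<otimes> b = \<one>" "t \<otimes> t = \<one>"
  shows "(b \<otimes> t \<otimes> b) \<otimes> (b \<otimes> t \<otimes> b) = \<one>"
proof -
  have "(b \<otimes> t \<otimes> b) \<otimes> (b \<otimes> t \<otimes> b) = b \<otimes> t \<otimes> (b \<otimes> b) \<otimes> t \<otimes> b"
    using c by (simp only: m_assoc m_closed)
  also have "\<dots> = b \<otimes> (t \<otimes> t) \<otimes> b" using c r by (simp add: m_assoc)
  finally show ?thesis using c r by simp
qed

lemma twisted_commute:
  assumes c: "a \<in> carrier G" "b \<in> carrier G" "t \<in> carrier G"
    and r: "a \<otimes> a = \<one>" "b \<otimes> b = \<one>" "t \<otimes> t = \<one>"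
      "(a \<otimes> b) [^] (2::nat) = \<one>" "(a \<otimes> t) [^] (2::nat) = \<one>"
  shows "(a \<otimes> (b \<otimes> t \<otimes> b)) [^] (2::nat) = \<one>"
proof -
  have "a \<otimes> (b \<otimes> t \<otimes> b) = (a \<otimes> b) \<otimes> t \<otimes> b" using c by (simp add: m_assoc)
  also have "\<dots> = b \<otimes> (a \<otimes> t) \<otimes> b"
    using c commute_of_rel[OF c(1,2) r(1,2,4)] by (simp add: m_assoc)
  finally show ?thesis
    using conj_pow[of b "a \<otimes> t" 2] inv_involution[OF c(2) r(2)] c r by simp
qed

lemma twisted_4:
  assumes c: "a \<in> carrier G" "b \<in> carrier G" "t \<in> carrier G"
    and r: "a \<otimes> a = \<one>" "b \<otimes> b = \<one>" "t \<otimes> t = \<one>"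
      "(a \<otimes> b) [^] (3::nat) = \<one>" "(a \<otimes> t) [^] (2::nat) = \<one>" "(b \<otimes> t) [^] (4::nat) = \<one>"
  shows "(a \<otimes> (b \<otimes> t \<otimes> b)) [^] (4::nat) = \<one>"
proof -
  note br = braid_of_rel[OF c(1,2) r(1,2,4)] and cm = commute_of_rel[OF c(1,3) r(1,3,5)]
  have i: "inv (b \<otimes> a) = a \<otimes> b"
    using c r inv_involution by (simp add: inv_mult_group)
  have "(b \<otimes> a) \<otimes> (b \<otimes> t) \<otimes> (a \<otimes> b) = b \<otimes> (a \<otimes> b) \<otimes> (t \<otimes> a) \<otimes> b"
    using c by (simp add: m_assoc)
  also have "\<dots> = a \<otimes> (b \<otimes> a) \<otimes> (a \<otimes> t) \<otimes> b"
    using c br cm by simp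
  also have "\<dots> = a \<otimes> b \<otimes> (a \<otimes> a) \<otimes> t \<otimes> b"
    using c by (simp only: m_assoc m_closed)
  also have "\<dots> = a \<otimes> (b \<otimes> t \<otimes> b)" using c r by (simp add: m_assoc)
  finally have "a \<otimes> (b \<otimes> t \<otimes> b) = (b \<otimes> a) \<otimes> (b \<otimes> t) \<otimes> inv (b \<otimes> a)" using i by simp
  then show ?thesis using conj_pow[of "b \<otimes> a" "b \<otimes> t" 4] c r(6) by simp
qed

end

lemma matrix_diag [simp]: "matrix_C m s s = 1" "matrix_B m s s = 1"
  by (simp_all add: matrix_C_def matrix_B_def)

lemma matrix_sym: "matrix_C m s t = matrix_C m t s" "matrix_B m s t = matrix_B m t s"
proof -
  have "{s, t} = {t, s}" "s = t \<longleftrightarrow> t = s" by auto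
  then show "matrix_C m s t = matrix_C m t s" "matrix_B m s t = matrix_B m t s"
    unfolding matrix_C_def matrix_B_def by (simp_all only:)
qed

lemma matrix_C_simps:
  "i < m \<Longrightarrow> j < m \<Longrightarrow> matrix_C m (Sig i) (Sig j) =
     (if i = j then 1 else if i = 0 \<and> j = 1 \<or> i = 1 \<and> j = 0 then 4
      else if i = j + 1 \<or> j = i + 1 then 3 else 2)"
  "matrix_C m (Sig i) (Tm m) = (if i = m - 1 then 4 else 2)"
  "matrix_C (m + 1) (Sig i) (Tm (m + 1)) = (if i = m then 4 else 2)"
proof -
  assume "i < m" "j < m"
  then have "(\<exists>k\<in>{1..m - 2}. {Sig i, Sig j} = {Sig k, Sig (k + 1)}) \<longleftrightarrow>
      i \<ge> 1 \<and> j \<ge> 1 \<and> (i = j + 1 \<or> j = i + 1)"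
    by (auto simp: doubleton_eq_iff Bex_def)
  then show "matrix_C m (Sig i) (Sig j) =
     (if i = j then 1 else if i = 0 \<and> j = 1 \<or> i = 1 \<and> j = 0 then 4
      else if i = j + 1 \<or> j = i + 1 then 3 else 2)"
    by (auto simp: matrix_C_def doubleton_eq_iff)
qed (auto simp: matrix_C_def doubleton_eq_iff)

lemma matrix_B_simps:
  "i \<in> {1..<m} \<Longrightarrow> j \<in> {1..<m} \<Longrightarrow> matrix_B m (Sig i) (Sig j) =
     (if i = j then 1 else if i = j + 1 \<or> j = i + 1 then 3 else 2)"
  "matrix_B m (Sig i) (Tm m) = (if i = m - 1 then 4 else 2)"
  "matrix_B (m + 1) (Sig i) (Tm (m + 1)) = (if i = m then 4 else 2)"
  "matrix_B m Sigbar (Sig j) = (if j = 2 then 3 else 2)"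
  "matrix_B m (Sig j) Sigbar = (if j = 2 then 3 else 2)"
  "matrix_B m Sigbar (Tm k) = 2"
proof -
  assume "i \<in> {1..<m}" "j \<in> {1..<m}"
  then have "(\<exists>k\<in>{1..m - 2}. {Sig i, Sig j} = {Sig k, Sig (k + 1)}) \<longleftrightarrow>
      (i = j + 1 \<or> j = i + 1)"
    by (auto simp: doubleton_eq_iff Bex_def)
  then show "matrix_B m (Sig i) (Sig j) =
     (if i = j then 1 else if i = j + 1 \<or> j = i + 1 then 3 else 2)"
    by (auto simp: matrix_B_def doubleton_eq_iff)
qed (auto simp: matrix_B_def doubleton_eq_iff)

lemma group_W: "group (W_C m)" "group (W_B m)"
  unfolding W_C_def W_B_def by (rule group_coxeter_group, simp)+

lemma gen_closed:
  "s \<in> gens_C m \<Longrightarrow> gen_C m s \<in> carrier (W_C m)"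
  "s \<in> gens_B m \<Longrightarrow> gen_B m s \<in> carrier (W_B m)"
  by (simp_all add: gen_C_def gen_B_def W_C_def W_B_def)

lemma gen_C_rel:
  "s \<in> gens_C m \<Longrightarrow> t \<in> gens_C m \<Longrightarrow> matrix_C m s t = k \<Longrightarrow>
    (gen_C m s \<otimes>\<^bsub>W_C m\<^esub> gen_C m t) [^]\<^bsub>W_C m\<^esub> k = \<one>\<^bsub>W_C m\<^esub>"
  using coxeter_gen_rel[of "gens_C m" "matrix_C m" s t] by (simp add: gen_C_def W_C_def)

lemma gen_B_rel:
  "s \<in> gens_B m \<Longrightarrow> t \<in> gens_B m \<Longrightarrow> matrix_B m s t = k \<Longrightarrow>
    (gen_B m s \<otimes>\<^bsub>W_B m\<^esub> gen_B m t) [^]\<^bsub>W_B m\<^esub> k = \<one>\<^bsub>W_B m\<^esub>"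
  using coxeter_gen_rel[of "gens_B m" "matrix_B m" s t] by (simp add: gen_B_def W_B_def)

lemma gen_C_square:
  assumes "s \<in> gens_C m" shows "gen_C m s \<otimes>\<^bsub>W_C m\<^esub> gen_C m s = \<one>\<^bsub>W_C m\<^esub>"
proof -
  interpret group "W_C m" by (rule group_W)
  show ?thesis using gen_C_rel[OF assms assms, of 1] gen_closed(1)[OF assms] by simp
qed

lemma gen_B_square:
  assumes "s \<in> gens_B m" shows "gen_B m s \<otimes>\<^bsub>W_B m\<^esub> gen_B m s = \<one>\<^bsub>W_B m\<^esub>"
proof -
  interpret group "W_B m" by (rule group_W)
  show ?thesis using gen_B_rel[OF assms assms, of 1] gen_closed(2)[OF assms] by simp
qed

lemma images_F_closed: "2 \<le> n \<Longrightarrow> images_F n \<in> gens_C n \<rightarrow> carrier (W_C (n + 1))"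
proof
  fix s assume n: "2 \<le> n" and s: "s \<in> gens_C n"
  interpret group "W_C (Suc n)" by (rule group_W)
  have "gen_C (n + 1) (Sig n) \<in> carrier (W_C (n + 1))"
    "gen_C (n + 1) (Tm (n + 1)) \<in> carrier (W_C (n + 1))"
    by (rule gen_closed, simp add: gens_C_def)+
  moreover have "s \<noteq> Tm n \<Longrightarrow> gen_C (n + 1) s \<in> carrier (W_C (n + 1))"
    by (rule gen_closed) (use s in \<open>auto simp: gens_C_def\<close>)
  ultimately show "images_F n s \<in> carrier (W_C (n + 1))" by (auto simp: images_F_def)
qed

lemma images_L_closed: "3 \<le> n \<Longrightarrow> images_L n \<in> gens_B n \<rightarrow> carrier (W_B (n + 1))"
proof
  fix s assume n: "3 \<le> n" and s: "s \<in> gens_B n"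
  interpret group "W_B (Suc n)" by (rule group_W)
  have "gen_B (n + 1) (Sig n) \<in> carrier (W_B (n + 1))"
    "gen_B (n + 1) (Tm (n + 1)) \<in> carrier (W_B (n + 1))"
    by (rule gen_closed, use n in \<open>simp add: gens_B_def\<close>)+
  moreover have "s \<noteq> Tm n \<Longrightarrow> gen_B (n + 1) s \<in> carrier (W_B (n + 1))"
    by (rule gen_closed) (use s in \<open>auto simp: gens_B_def\<close>)
  ultimately show "images_L n s \<in> carrier (W_B (n + 1))" by (auto simp: images_L_def)
qed

lemma matrix_C_step:
  assumes n: "2 \<le> n"
  shows "matrix_C n (Sig (n - 1)) (Tm n) = 4" "matrix_C (n + 1) (Sig (n - 1)) (Sig n) = 3"
    "matrix_C (n + 1) (Sig (n - 1)) (Tm (n + 1)) = 2" "matrix_C (n + 1) (Sig n) (Tm (n + 1)) = 4"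
    "r \<in> gens_C n \<Longrightarrow> r \<noteq> Tm n \<Longrightarrow> r \<noteq> Sig (n - 1) \<Longrightarrow> matrix_C n r (Tm n) = 2"
    "r \<in> gens_C n \<Longrightarrow> r \<noteq> Tm n \<Longrightarrow> r \<noteq> Sig (n - 1) \<Longrightarrow> matrix_C (n + 1) r (Sig n) = 2"
    "r \<in> gens_C n \<Longrightarrow> r \<noteq> Tm n \<Longrightarrow> r \<noteq> Sig (n - 1) \<Longrightarrow> matrix_C (n + 1) r (Tm (n + 1)) = 2"
    "s \<in> gens_C n \<Longrightarrow> s \<noteq> Tm n \<Longrightarrow> t \<in> gens_C n \<Longrightarrow> t \<noteq> Tm n \<Longrightarrow>
       matrix_C (n + 1) s t = matrix_C n s t"
proof -
  show "matrix_C n (Sig (n - 1)) (Tm n) = 4" "matrix_C (n + 1) (Sig (n - 1)) (Sig n) = 3"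
    "matrix_C (n + 1) (Sig (n - 1)) (Tm (n + 1)) = 2" "matrix_C (n + 1) (Sig n) (Tm (n + 1)) = 4"
    using n by (simp_all add: matrix_C_simps)
  show "matrix_C n r (Tm n) = 2" "matrix_C (n + 1) r (Sig n) = 2"
    "matrix_C (n + 1) r (Tm (n + 1)) = 2"
    if "r \<in> gens_C n" "r \<noteq> Tm n" "r \<noteq> Sig (n - 1)"
    using n that by (auto simp: matrix_C_simps gens_C_def split: if_splits)
  show "matrix_C (n + 1) s t = matrix_C n s t"
    if "s \<in> gens_C n" "s \<noteq> Tm n" "t \<in> gens_C n" "t \<noteq> Tm n"
    using n that by (auto simp: matrix_C_simps gens_C_def split: if_splits)
qed

lemma images_F_rel:
  assumes n: "2 \<le> n" and s: "s \<in> gens_C n" and t: "t \<in> gens_C n"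
  shows "(images_F n s \<otimes>\<^bsub>W_C (n + 1)\<^esub> images_F n t) [^]\<^bsub>W_C (n + 1)\<^esub> matrix_C n s t = \<one>\<^bsub>W_C (n + 1)\<^esub>"
proof -
  interpret group "W_C (Suc n)" by (rule group_W)
  let ?g = "gen_C (n + 1)" and ?T = "Tm (n + 1)"
  have b: "Sig n \<in> gens_C (n + 1)" "?T \<in> gens_C (n + 1)" by (simp_all add: gens_C_def)
  have up: "r \<in> gens_C (n + 1)" if "r \<in> gens_C n" "r \<noteq> Tm n" for r
    using that by (auto simp: gens_C_def)
  have mixed: "(images_F n r \<otimes>\<^bsub>W_C (n + 1)\<^esub> images_F n (Tm n)) [^]\<^bsub>W_C (n + 1)\<^esub> matrix_C n r (Tm n)
      = \<one>\<^bsub>W_C (n + 1)\<^esub>" if r: "r \<in> gens_C n" "r \<noteq> Tm n" for r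
  proof (cases "r = Sig (n - 1)")
    case True
    have m: "matrix_C n r (Tm n) = 4" "matrix_C (n + 1) r (Sig n) = 3"
      "matrix_C (n + 1) r ?T = 2" "matrix_C (n + 1) (Sig n) ?T = 4"
      using matrix_C_step(1-4)[OF n] by (simp_all add: True)
    show ?thesis
      using twisted_4[of "?g r" "?g (Sig n)" "?g ?T"] up[OF r] b m r
      by (simp add: images_F_def gen_closed gen_C_square gen_C_rel)
  next
    case False
    have m: "matrix_C n r (Tm n) = 2" "matrix_C (n + 1) r (Sig n) = 2" "matrix_C (n + 1) r ?T = 2"
      using matrix_C_step(5-7)[OF n r False] by simp_all
    show ?thesis
      using twisted_commute[of "?g r" "?g (Sig n)" "?g ?T"] up[OF r] b m r
      by (simp add: images_F_def gen_closed gen_C_square gen_C_rel)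
  qed
  have cl: "images_F n r \<in> carrier (W_C (n + 1))" if "r \<in> gens_C n" for r
    using images_F_closed[OF n] that by blast
  consider "s = Tm n" "t = Tm n" | "s \<noteq> Tm n" "t = Tm n" | "s = Tm n" "t \<noteq> Tm n"
    | "s \<noteq> Tm n" "t \<noteq> Tm n" by blast
  then show ?thesis
  proof cases
    case 1
    then show ?thesis
      using twisted_involution[of "?g (Sig n)" "?g ?T"] b
      by (simp add: images_F_def gen_closed gen_C_square)
  next
    case 2
    then show ?thesis using mixed s by blast
  next
    case 3
    then show ?thesis
      using pow_swap[of "images_F n t" "images_F n s"] cl[OF s] cl[OF t] mixed[OF t]
      by (simp add: matrix_sym[of n "Tm n" t])
  next
    case 4
    have "matrix_C (n + 1) s t = matrix_C n s t"
      using matrix_C_step(8)[OF n s 4(1) t 4(2)] .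
    then show ?thesis using gen_C_rel[OF up[OF s 4(1)] up[OF t 4(2)]] 4 by (simp add: images_F_def)
  qed
qed

lemma matrix_B_step:
  assumes n: "3 \<le> n"
  shows "matrix_B n (Sig (n - 1)) (Tm n) = 4" "matrix_B (n + 1) (Sig (n - 1)) (Sig n) = 3"
    "matrix_B (n + 1) (Sig (n - 1)) (Tm (n + 1)) = 2" "matrix_B (n + 1) (Sig n) (Tm (n + 1)) = 4"
    "r \<in> gens_B n \<Longrightarrow> r \<noteq> Tm n \<Longrightarrow> r \<noteq> Sig (n - 1) \<Longrightarrow> matrix_B n r (Tm n) = 2"
    "r \<in> gens_B n \<Longrightarrow> r \<noteq> Tm n \<Longrightarrow> r \<noteq> Sig (n - 1) \<Longrightarrow> matrix_B (n + 1) r (Sig n) = 2"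
    "r \<in> gens_B n \<Longrightarrow> r \<noteq> Tm n \<Longrightarrow> r \<noteq> Sig (n - 1) \<Longrightarrow> matrix_B (n + 1) r (Tm (n + 1)) = 2"
    "s \<in> gens_B n \<Longrightarrow> s \<noteq> Tm n \<Longrightarrow> t \<in> gens_B n \<Longrightarrow> t \<noteq> Tm n \<Longrightarrow>
       matrix_B (n + 1) s t = matrix_B n s t"
proof -
  have i: "Suc 0 \<le> n - Suc 0" using n by arith
  show "matrix_B n (Sig (n - 1)) (Tm n) = 4" "matrix_B (n + 1) (Sig (n - 1)) (Sig n) = 3"
    "matrix_B (n + 1) (Sig (n - 1)) (Tm (n + 1)) = 2" "matrix_B (n + 1) (Sig n) (Tm (n + 1)) = 4"
    using n i by (simp_all add: matrix_B_simps)
  show "matrix_B n r (Tm n) = 2" "matrix_B (n + 1) r (Sig n) = 2"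
    "matrix_B (n + 1) r (Tm (n + 1)) = 2"
    if "r \<in> gens_B n" "r \<noteq> Tm n" "r \<noteq> Sig (n - 1)"
    using n that by (auto simp: matrix_B_simps gens_B_def split: if_splits) arith+
  show "matrix_B (n + 1) s t = matrix_B n s t"
    if "s \<in> gens_B n" "s \<noteq> Tm n" "t \<in> gens_B n" "t \<noteq> Tm n"
    using n that by (auto simp: matrix_B_simps gens_B_def split: if_splits)
qed

lemma images_L_rel:
  assumes n: "3 \<le> n" and s: "s \<in> gens_B n" and t: "t \<in> gens_B n"
  shows "(images_L n s \<otimes>\<^bsub>W_B (n + 1)\<^esub> images_L n t) [^]\<^bsub>W_B (n + 1)\<^esub> matrix_B n s t = \<one>\<^bsub>W_B (n + 1)\<^esub>"
proof -
  interpret group "W_B (Suc n)" by (rule group_W)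
  let ?g = "gen_B (n + 1)" and ?T = "Tm (n + 1)"
  have b: "Sig n \<in> gens_B (n + 1)" "?T \<in> gens_B (n + 1)" using n by (simp_all add: gens_B_def)
  have up: "r \<in> gens_B (n + 1)" if "r \<in> gens_B n" "r \<noteq> Tm n" for r
    using that by (auto simp: gens_B_def)
  have mixed: "(images_L n r \<otimes>\<^bsub>W_B (n + 1)\<^esub> images_L n (Tm n)) [^]\<^bsub>W_B (n + 1)\<^esub> matrix_B n r (Tm n)
      = \<one>\<^bsub>W_B (n + 1)\<^esub>" if r: "r \<in> gens_B n" "r \<noteq> Tm n" for r
  proof (cases "r = Sig (n - 1)")
    case True
    have m: "matrix_B n r (Tm n) = 4" "matrix_B (n + 1) r (Sig n) = 3"
      "matrix_B (n + 1) r ?T = 2" "matrix_B (n + 1) (Sig n) ?T = 4"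
      using matrix_B_step(1-4)[OF n] by (simp_all add: True)
    show ?thesis
      using twisted_4[of "?g r" "?g (Sig n)" "?g ?T"] up[OF r] b m r
      by (simp add: images_L_def gen_closed gen_B_square gen_B_rel)
  next
    case False
    have m: "matrix_B n r (Tm n) = 2" "matrix_B (n + 1) r (Sig n) = 2" "matrix_B (n + 1) r ?T = 2"
      using matrix_B_step(5-7)[OF n r False] by simp_all
    show ?thesis
      using twisted_commute[of "?g r" "?g (Sig n)" "?g ?T"] up[OF r] b m r
      by (simp add: images_L_def gen_closed gen_B_square gen_B_rel)
  qed
  have cl: "images_L n r \<in> carrier (W_B (n + 1))" if "r \<in> gens_B n" for r
    using images_L_closed[OF n] that by blast
  consider "s = Tm n" "t = Tm n" | "s \<noteq> Tm n" "t = Tm n" | "s = Tm n" "t \<noteq> Tm n"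
    | "s \<noteq> Tm n" "t \<noteq> Tm n" by blast
  then show ?thesis
  proof cases
    case 1
    then show ?thesis
      using twisted_involution[of "?g (Sig n)" "?g ?T"] b
      by (simp add: images_L_def gen_closed gen_B_square)
  next
    case 2
    then show ?thesis using mixed s by blast
  next
    case 3
    then show ?thesis
      using pow_swap[of "images_L n t" "images_L n s"] cl[OF s] cl[OF t] mixed[OF t]
      by (simp add: matrix_sym[of n "Tm n" t])
  next
    case 4
    have "matrix_B (n + 1) s t = matrix_B n s t"
      using matrix_B_step(8)[OF n s 4(1) t 4(2)] .
    then show ?thesis using gen_B_rel[OF up[OF s 4(1)] up[OF t 4(2)]] 4 by (simp add: images_L_def)
  qed
qed

theorem F_hom:
  assumes "2 \<le> n"
  shows "F_hom n \<in> hom (W_C n) (W_C (n + 1))"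
    and "\<And>s. s \<in> gens_C n \<Longrightarrow> F_hom n (gen_C n s) = images_F n s"
  using coxeter_lift[OF group_W(1) images_F_closed images_F_rel] assms
  unfolding F_hom_def W_C_def gen_C_def by blast+

theorem L_hom:
  assumes "3 \<le> n"
  shows "L_hom n \<in> hom (W_B n) (W_B (n + 1))"
    and "\<And>s. s \<in> gens_B n \<Longrightarrow> L_hom n (gen_B n s) = images_L n s"
  using coxeter_lift[OF group_W(2) images_L_closed images_L_rel] assms
  unfolding L_hom_def W_B_def gen_B_def by blast+

end

theory Submission
  imports Defs
begin

text \<open>
  Both families act on integer points as groups generated by affine reflections: \<open>Sig i\<close> with
  \<open>i \<ge> 1\<close> exchanges the coordinates \<open>i\<close> and \<open>i + 1\<close>, \<open>Sig 0\<close> negates the first coordinate,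
  \<open>Sigbar\<close> exchanges the first two coordinates and negates both, and \<open>Tm m\<close> sends the coordinate
  \<open>x\<close> at \<open>m\<close> to \<open>2 K - x\<close>. Let \<open>p\<close> be a point of the open fundamental alcove, on which every
  functional \<open>\<alpha> s\<close> that defines the wall of a generator \<open>s\<close> is positive. Tits's argument
  (\<open>reduced_Cons_iff\<close>) shows that, for a reduced word \<open>w\<close>, the word \<open>s # w\<close> is reduced if and only
  if the image of \<open>p\<close> under \<open>w\<close> lies on the positive side of the wall of \<open>s\<close>.

  On words, the two homomorphisms substitute \<open>Sig n, Tm (n + 1), Sig n\<close> for \<open>Tm n\<close>. These three
  letters together act as \<open>Tm n\<close> does, and all other letters keep their action. So \<open>p\<close> has the same
  image under a word and under its substituted word, and the coordinate \<open>n + 1\<close> of that image is the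
  one of \<open>p\<close>. By induction, substitution preserves reducedness (\<open>reduced_word_image\<close>). The only case
  with content is a letter \<open>Tm n\<close>: choose \<open>p\<close> so that no point of its orbit under the smaller group
  has its coordinate \<open>n\<close> between the coordinate \<open>n + 1\<close> of \<open>p\<close> and \<open>K\<close>. Then a point on the positive
  side of the wall of \<open>Tm n\<close> crosses the three walls of the substituted letters one after the other,
  each from its positive side.

  A reduced word \<open>w\<close> with \<open>k\<close> letters \<open>Tm n\<close> thus yields a reduced word of length
  \<open>length w + 2 * k\<close> with \<open>k\<close> letters \<open>Tm (n + 1)\<close>. Since the length of the image depends only on
  the group element, so does \<open>k\<close>. Hence the affine length is well defined, and both formulas follow.
\<close>


section \<open>Reduced words\<close>

text \<open>
  A word is reduced if no shorter word represents the same group element. Working with words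
  instead of group elements keeps the letter counts available.
\<close>

definition reduced_word :: "'s set \<Rightarrow> ('s \<Rightarrow> 's \<Rightarrow> nat) \<Rightarrow> 's list \<Rightarrow> bool" where
  "reduced_word S M w \<longleftrightarrow> w \<in> lists S \<and> (\<forall>u. coxeter_eq S M w u \<longrightarrow> length w \<le> length u)"

lemma reduced_word_lists: "reduced_word S M w \<Longrightarrow> w \<in> lists S"
  by (simp add: reduced_word_def)

lemma reduced_word_le: "reduced_word S M w \<Longrightarrow> coxeter_eq S M w u \<Longrightarrow> length w \<le> length u"
  by (simp add: reduced_word_def)

lemma reduced_word_cong:
  assumes "reduced_word S M w" "coxeter_eq S M w u" "length u \<le> length w"
  shows "reduced_word S M u"
  unfolding reduced_word_def
proof (intro conjI allI impI)
  show "u \<in> lists S" using coxeter_eq_lists[OF assms(2)] by simp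
  fix v assume "coxeter_eq S M u v"
  then have "coxeter_eq S M w v" using assms(2) coxeter_eq.trans by metis
  then show "length u \<le> length v" using reduced_word_le[OF assms(1)] assms(3) by force
qed

lemma reduced_word_exists:
  assumes "w \<in> lists S"
  obtains u where "reduced_word S M u" "coxeter_eq S M w u"
proof -
  obtain u where u: "coxeter_eq S M w u" "\<And>v. coxeter_eq S M w v \<Longrightarrow> length u \<le> length v"
    using ex_has_least_nat[of "coxeter_eq S M w" w length] coxeter_eq.refl[OF assms] by blast
  then have "reduced_word S M u"
    unfolding reduced_word_def using coxeter_eq.trans[OF u(1)] coxeter_eq_lists[OF u(1)] by blast
  then show ?thesis using u(1) that by blast
qed

lemma reduced_word_factor:
  assumes "reduced_word S M (u @ v @ w)"
  shows "reduced_word S M v"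
  unfolding reduced_word_def
proof (intro conjI allI impI)
  have l: "u \<in> lists S" "v \<in> lists S" "w \<in> lists S"
    using reduced_word_lists[OF assms] by auto
  then show "v \<in> lists S" by simp
  fix x assume "coxeter_eq S M v x"
  then have "coxeter_eq S M (u @ v @ w) (u @ x @ w)"
    using l by (intro coxeter_eq.append coxeter_eq.refl)
  then show "length v \<le> length x" using reduced_word_le[OF assms] by fastforce
qed

lemma reduced_word_Cons: "reduced_word S M (s # w) \<Longrightarrow> reduced_word S M w"
  using reduced_word_factor[of S M "[s]" w "[]"] by simp

lemma reduced_expression_iff:
  "reduced_expression S M x w \<longleftrightarrow> reduced_word S M w \<and> coxeter_elt S M w = x"
proof (cases "w \<in> lists S \<and> coxeter_elt S M w = x")
  case True
  have ex: "expression S M x u \<longleftrightarrow> coxeter_eq S M w u" for u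
    using True coxeter_elt_eq_iff coxeter_eq_lists unfolding expression_iff by metis
  have "length w = coxeter_length S M x \<longleftrightarrow> (\<forall>u. coxeter_eq S M w u \<longrightarrow> length w \<le> length u)"
    (is "?l \<longleftrightarrow> ?r")
  proof
    assume ?l
    then show ?r unfolding coxeter_length_def ex by (auto intro: Least_le)
  next
    assume ?r
    moreover have "coxeter_eq S M w w" by (rule coxeter_eq.refl) (use True in simp)
    ultimately have "(LEAST k. \<exists>u. coxeter_eq S M w u \<and> length u = k) = length w"
      by (intro Least_equality) auto
    then show ?l by (simp add: coxeter_length_def ex)
  qed
  then show ?thesis
    using True by (simp add: reduced_expression_def reduced_word_def expression_iff)
next
  case False
  then have "\<not> reduced_expression S M x w"
    by (auto simp: reduced_expression_def expression_iff)
  moreover have "\<not> (reduced_word S M w \<and> coxeter_elt S M w = x)"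
    using False reduced_word_lists[of S M w] by blast
  ultimately show ?thesis by blast
qed

lemma coxeter_length_eq: "reduced_word S M w \<Longrightarrow> coxeter_length S M (coxeter_elt S M w) = length w"
  using reduced_expression_iff[of S M "coxeter_elt S M w" w] by (simp add: reduced_expression_def)

text \<open>
  Every relator has even length, so the length of a word modulo 2 depends only on the group
  element that it represents.
\<close>

lemma coxeter_eq_parity: "coxeter_eq S M u v \<Longrightarrow> even (length u) \<longleftrightarrow> even (length v)"
proof (induction rule: coxeter_eq.induct)
  case (rel s t)
  have "length (concat (replicate k [s, t])) = 2 * k" for k by (induction k) auto
  then show ?case by simp
qed auto

lemma alternating_cases:
  assumes "set a \<subseteq> {s, r}" "distinct_adj (s # a)"
  shows "a \<in> {[], [r], [r, s], [r, s, r]} \<or> (\<exists>w. a = [r, s, r, s] @ w)"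
proof -
  consider "a = []" | x where "a = [x]" | x y where "a = [x, y]" | x y z where "a = [x, y, z]"
    | x y z u w where "a = x # y # z # u # w"
    by (metis list.exhaust)
  then show ?thesis using assms by cases auto
qed


section \<open>Groups acting on points by reflections\<close>

text \<open>
  A point is an integer vector. Each generator \<open>s\<close> has an affine functional \<open>\<alpha> s\<close> and a direction
  \<open>v s\<close>, and acts as the affine reflection \<open>q \<mapsto> q - \<alpha> s q \<cdot> v s\<close>. The number \<open>c s r\<close>
  is the value of the linear part of \<open>\<alpha> s\<close> on \<open>v r\<close>, an entry of a Cartan matrix; the last
  assumption says that the Cartan matrix has only the entries that belong to the Coxeter
  exponents 2, 3 and 4. The base point \<open>p\<close> lies in the open chamber on which all \<open>\<alpha> s\<close> are
  positive.
\<close>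

locale reflection_representation =
  fixes S :: "'s set" and M :: "'s \<Rightarrow> 's \<Rightarrow> nat"
    and \<alpha> :: "'s \<Rightarrow> ('i \<Rightarrow> int) \<Rightarrow> int" and v :: "'s \<Rightarrow> 'i \<Rightarrow> int" and c :: "'s \<Rightarrow> 's \<Rightarrow> int"
    and p :: "'i \<Rightarrow> int"
  assumes diag: "s \<in> S \<Longrightarrow> M s s = 1"
    and \<alpha>_shift: "s \<in> S \<Longrightarrow> r \<in> S \<Longrightarrow> \<alpha> s (\<lambda>i. q i - a * v r i) = \<alpha> s q - a * c s r"
    and c_diag: "s \<in> S \<Longrightarrow> c s s = 2"
    and cartan: "s \<in> S \<Longrightarrow> r \<in> S \<Longrightarrow> s \<noteq> r \<Longrightarrow>
      (M s r, c s r, c r s) \<in> {(2, 0, 0), (3, -1, -1), (4, -1, -2), (4, -2, -1)}"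
    and base: "s \<in> S \<Longrightarrow> \<alpha> s p > 0"
begin

text \<open>
  The reflection in the wall of \<open>s\<close>. A word acts by \<open>foldr act\<close>, so its last letter acts first.
\<close>

definition act :: "'s \<Rightarrow> ('i \<Rightarrow> int) \<Rightarrow> 'i \<Rightarrow> int" where
  "act s q = (\<lambda>i. q i - \<alpha> s q * v s i)"

lemma \<alpha>_act: "s \<in> S \<Longrightarrow> r \<in> S \<Longrightarrow> \<alpha> s (act r q) = \<alpha> s q - \<alpha> r q * c s r"
  unfolding act_def by (rule \<alpha>_shift)

lemma \<alpha>_act_self: "s \<in> S \<Longrightarrow> \<alpha> s (act s q) = - \<alpha> s q"
  by (simp add: \<alpha>_act c_diag)

lemma act_coxeter_rel:
  assumes "s \<in> S" "r \<in> S"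
  shows "foldr act (concat (replicate (M s r) [s, r])) q = q"
proof (cases "s = r")
  case True
  have "act s (act s q) = q" using assms by (auto simp: act_def[of s "act s q"] \<alpha>_act_self) (auto simp: act_def)
  then show ?thesis using True diag assms by simp
next
  case False
  note sr = \<alpha>_act[OF assms(1) assms(2)] \<alpha>_act[OF assms(2) assms(1)]
    \<alpha>_act_self[OF assms(1)] \<alpha>_act_self[OF assms(2)]
  have e: "act s q' i = q' i - \<alpha> s q' * v s i" "act r q' i = q' i - \<alpha> r q' * v r i" for q' i
    by (simp_all add: act_def)
  show ?thesis
    using cartan[OF assms False]
    by (elim insertE emptyE) (auto simp: numeral_eq_Suc fun_eq_iff e sr algebra_simps)
qed

lemma act_coxeter_eq: "coxeter_eq S M u w \<Longrightarrow> foldr act u q = foldr act w q"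
  by (induction arbitrary: q rule: coxeter_eq.induct) (simp_all add: act_coxeter_rel)

lemma coxeter_eq_cancel:
  assumes "s \<in> S" "w \<in> lists S"
  shows "coxeter_eq S M (s # s # w) w"
  using coxeter_eq.append[OF coxeter_eq.rel[OF assms(1,1)] coxeter_eq.refl[OF assms(2)], of M]
  by (simp add: diag assms)

lemma coxeter_eq_Cons: "s \<in> S \<Longrightarrow> coxeter_eq S M u w \<Longrightarrow> coxeter_eq S M (s # u) (s # w)"
  using coxeter_eq.append[OF coxeter_eq.refl[of "[s]" S M]] by simp

lemma not_reduced_square: "\<not> reduced_word S M (s # s # w)"
proof
  assume r: "reduced_word S M (s # s # w)"
  then have "s \<in> S" "w \<in> lists S" using reduced_word_lists[OF r] by auto
  then show False using reduced_word_le[OF r coxeter_eq_cancel] by simp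
qed

lemma reduced_word_distinct_adj: "reduced_word S M w \<Longrightarrow> distinct_adj w"
proof (induction w)
  case (Cons x w)
  then show ?case using reduced_word_Cons[OF Cons.prems] not_reduced_square
    by (cases w) auto
qed simp

text \<open>A relator \<open>u @ w\<close> shows that \<open>u\<close> represents the same element as the reversal of \<open>w\<close>.\<close>

lemma not_reduced_relator_half:
  assumes "u @ w = concat (replicate (M s r) [s, r])" "s \<in> S" "r \<in> S" "length w < length u"
  shows "\<not> reduced_word S M u"
proof
  assume u: "reduced_word S M u"
  have e: "coxeter_eq S M (u @ w) []" using assms coxeter_eq.rel by metis
  then have l: "u \<in> lists S" "w \<in> lists S" "rev w \<in> lists S"
    using coxeter_eq_lists[OF e] by auto
  have w: "coxeter_eq S M (w @ rev w) []"
    using coxeter_eq_rev[of S M "rev w"] l diag by simp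
  have "coxeter_eq S M (u @ w @ rev w) u"
    using coxeter_eq.append[OF coxeter_eq.refl[OF l(1)] w] by simp
  moreover have "coxeter_eq S M (u @ w @ rev w) (rev w)"
    using coxeter_eq.append[OF e coxeter_eq.refl[OF l(3)]] by simp
  ultimately have "coxeter_eq S M u (rev w)" by (meson coxeter_eq.sym coxeter_eq.trans)
  then show False using reduced_word_le[OF u] assms(4) by fastforce
qed

text \<open>
  If prefixing \<open>s\<close> to a reduced word does not give a reduced word, then the element has a reduced
  expression that begins with \<open>s\<close>.
\<close>

lemma descent:
  assumes w: "reduced_word S M w" and s: "s \<in> S" and n: "\<not> reduced_word S M (s # w)"
  obtains u where "reduced_word S M (s # u)" "coxeter_eq S M w (s # u)" "length w = Suc (length u)"
proof -
  have l: "s # w \<in> lists S" using s reduced_word_lists[OF w] by simp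
  obtain u where u: "reduced_word S M u" "coxeter_eq S M (s # w) u"
    using reduced_word_exists[OF l] by blast
  have "length u < length (s # w)"
    using reduced_word_cong[OF u(1) coxeter_eq.sym[OF u(2)]] n by fastforce
  moreover have "length u \<noteq> length w"
    using coxeter_eq_parity[OF u(2)] by auto
  moreover have e: "coxeter_eq S M w (s # u)"
    using coxeter_eq_cancel[OF s reduced_word_lists[OF w]] coxeter_eq_Cons[OF s u(2)]
    by (meson coxeter_eq.sym coxeter_eq.trans)
  moreover note reduced_word_le[OF w e]
  ultimately have "length w = Suc (length u)" by simp
  with e that reduced_word_cong[OF w e] show ?thesis by simp
qed

text \<open>
  The dihedral case: if \<open>q\<close> is on the positive side of the walls of \<open>s\<close> and \<open>r\<close>, then \<open>\<alpha> s\<close> at the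
  image of \<open>q\<close> is a combination of \<open>\<alpha> s q\<close> and \<open>\<alpha> r q\<close> with nonnegative coefficients. As \<open>s # a\<close>
  is reduced, \<open>a\<close> is an alternating word with fewer than \<open>M s r\<close> letters, which leaves at most four
  words to check.
\<close>

lemma dihedral_positive:
  assumes s: "s \<in> S" and r: "r \<in> S" and ne: "s \<noteq> r" and a: "a \<in> lists {s, r}"
    and red: "reduced_word S M (s # a)" and pos: "\<alpha> s q > 0" "\<alpha> r q > 0"
  shows "\<alpha> s (foldr act a q) > 0"
proof -
  note sr = \<alpha>_act[OF s r] \<alpha>_act[OF r s] \<alpha>_act_self[OF s] \<alpha>_act_self[OF r]
  have "set a \<subseteq> {s, r}" using a by (simp add: in_lists_conv_set subset_iff)
  from alternating_cases[OF this reduced_word_distinct_adj[OF red]]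
  have alt: "a \<in> {[], [r], [r, s], [r, s, r]} \<or> (\<exists>w. a = [r, s, r, s] @ w)" .
  have half: "\<not> reduced_word S M (u @ w)"
    if "u @ x = concat (replicate (M s r) [s, r])" "length x < length u" for u x w
    using not_reduced_relator_half[OF that(1) s r that(2)] reduced_word_factor[of S M "[]" u w] by auto
  from cartan[OF s r ne] consider
    (2) "M s r = 2" "c s r = 0" "c r s = 0" | (3) "M s r = 3" "c s r = -1" "c r s = -1"
    | (4) "M s r = 4" "c s r = -1 \<and> c r s = -2 \<or> c s r = -2 \<and> c r s = -1" by auto
  then show ?thesis
  proof cases
    case 2
    then have "\<not> reduced_word S M ([s, r, s] @ w)" for w
      by (intro half[of _ "[r]"]) (auto simp: numeral_eq_Suc)
    then have "a \<in> {[], [r]}" using alt red by auto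
    then show ?thesis using pos 2 by (auto simp: sr)
  next
    case 3
    then have "\<not> reduced_word S M ([s, r, s, r] @ w)" for w
      by (intro half[of _ "[s, r]"]) (auto simp: numeral_eq_Suc)
    then have "a \<in> {[], [r], [r, s]}" using alt red by auto
    then show ?thesis using pos 3 by (auto simp: sr)
  next
    case 4
    then have "\<not> reduced_word S M ([s, r, s, r, s] @ w)" for w
      by (intro half[of _ "[r, s, r]"]) (auto simp: numeral_eq_Suc)
    then have "a \<in> {[], [r], [r, s], [r, s, r]}" using alt red by auto
    then show ?thesis using pos 4 by (auto simp: sr)
  qed
qed

text \<open>
  The induction step writes \<open>w\<close>, whose first letter is \<open>r\<close>, as \<open>a @ x\<close> with \<open>a\<close> in the
  letters \<open>s\<close> and \<open>r\<close> and \<open>x\<close> as short as possible. Then \<open>x\<close> can be extended on the left by \<open>s\<close> and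
  by \<open>r\<close>, so the induction hypothesis applies to \<open>x\<close> and both letters, and the dihedral case gives the
  sign for \<open>w\<close>.
\<close>

lemma reduced_Cons_positive:
  "reduced_word S M (s # w) \<Longrightarrow> \<alpha> s (foldr act w p) > 0"
proof (induction "length w" arbitrary: s w rule: less_induct)
  case less
  then have s: "s \<in> S" and w: "reduced_word S M w"
    using reduced_word_lists[OF less(2)] reduced_word_Cons by auto
  show ?case
  proof (cases w)
    case Nil
    then show ?thesis using base s by simp
  next
    case (Cons r w')
    then have r: "r \<in> S" and ne: "s \<noteq> r"
      using reduced_word_lists[OF less(2)] less(2) not_reduced_square by auto
    define D where "D a x \<longleftrightarrow> a \<in> lists {s, r} \<and> coxeter_eq S M w (a @ x) \<and>
      length w = length a + length x" for a x
    have "\<exists>a. D a w'"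
      using Cons coxeter_eq.refl[OF reduced_word_lists[OF w]] by (intro exI[of _ "[r]"]) (auto simp: D_def)
    then obtain x a where D: "D a x" and min: "\<And>y b. D b y \<Longrightarrow> length x \<le> length y"
      and xw: "length x \<le> length w'"
      using ex_has_least_nat[of "\<lambda>x. \<exists>a. D a x" w' length] by metis
    have a: "a \<in> lists {s, r}" and e: "coxeter_eq S M w (a @ x)" and len: "length w = length a + length x"
      using D by (auto simp: D_def)
    have ax: "reduced_word S M (a @ x)" using reduced_word_cong[OF w e] len by simp
    then have x: "reduced_word S M x" using reduced_word_factor[of S M a x "[]"] by simp
    have al: "a \<in> lists S" using a s r by auto
    \<comment> \<open>A descent of \<open>x\<close> by \<open>s\<close> or \<open>r\<close> could be moved into \<open>a\<close>, against the minimality of \<open>x\<close>.\<close>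
    have asc: "reduced_word S M (y # x)" if y: "y \<in> {s, r}" for y
    proof (rule ccontr)
      assume n: "\<not> reduced_word S M (y # x)"
      have yS: "y \<in> S" using y s r by auto
      obtain u where u: "coxeter_eq S M x (y # u)" "length x = Suc (length u)"
        using descent[OF x yS n] by metis
      have "coxeter_eq S M (a @ x) (a @ y # u)"
        using coxeter_eq.append[OF coxeter_eq.refl[OF al] u(1)] .
      then have "coxeter_eq S M w ((a @ [y]) @ u)" using e coxeter_eq.trans by fastforce
      then have "D (a @ [y]) u" using a y u len by (auto simp: D_def)
      then show False using min u(2) by fastforce
    qed
    have lx: "length x < length w" using xw Cons by simp
    have pos: "\<alpha> s (foldr act x p) > 0" "\<alpha> r (foldr act x p) > 0"
      using less(1)[OF lx] asc by auto
    have "reduced_word S M (s # a @ x)"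
      using reduced_word_cong[OF less(2) coxeter_eq_Cons[OF s e]] len by simp
    then have "reduced_word S M (s # a)" using reduced_word_factor[of S M "[]" "s # a" x] by simp
    then have "\<alpha> s (foldr act a (foldr act x p)) > 0"
      using dihedral_positive[OF s r ne a _ pos] by blast
    then show ?thesis using act_coxeter_eq[OF e] by simp
  qed
qed

theorem reduced_Cons_iff:
  assumes "reduced_word S M w" "s \<in> S"
  shows "reduced_word S M (s # w) \<longleftrightarrow> \<alpha> s (foldr act w p) > 0"
proof
  assume pos: "\<alpha> s (foldr act w p) > 0"
  show "reduced_word S M (s # w)"
  proof (rule ccontr)
    assume "\<not> reduced_word S M (s # w)"
    then obtain u where u: "reduced_word S M (s # u)" "coxeter_eq S M w (s # u)"
      using descent[OF assms] by metis
    have "\<alpha> s (foldr act w p) = - \<alpha> s (foldr act u p)"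
      using act_coxeter_eq[OF u(2)] \<alpha>_act_self[OF assms(2)] by simp
    then show False using reduced_Cons_positive[OF u(1)] pos by simp
  qed
qed (rule reduced_Cons_positive)

end


section \<open>The affine reflections of types B and C\<close>

text \<open>
  The fundamental alcove is given by \<open>0 < x\<^sub>1 < \<dots> < x\<^sub>m < K\<close> in type C and by
  \<open>- x\<^sub>2 < x\<^sub>1 < \<dots> < x\<^sub>m < K\<close> in type B. A single set of functionals serves both families and all
  ranks, since a generator \<open>Sig i\<close> or \<open>Sigbar\<close> acts in the same way for every rank.
  The linear part of the functional of each generator comes first.
\<close>

fun linear_part :: "generator \<Rightarrow> (nat \<Rightarrow> int) \<Rightarrow> int" where
  "linear_part (Sig i) q = (if i = 0 then q 1 else q (Suc i) - q i)"
| "linear_part Sigbar q = q 1 + q 2"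
| "linear_part (Tm m) q = - q m"

text \<open>
  The directions of the reflections, scaled so that each functional has linear part 2 on its own
  direction.
\<close>

fun direction :: "generator \<Rightarrow> nat \<Rightarrow> int" where
  "direction (Sig i) =
     (\<lambda>j. if i = 0 then if j = 1 then 2 else 0 else if j = i then -1 else if j = Suc i then 1 else 0)"
| "direction Sigbar = (\<lambda>j. if j = 1 \<or> j = 2 then 1 else 0)"
| "direction (Tm m) = (\<lambda>j. if j = m then -2 else 0)"

text \<open>The affine functional, which vanishes on the wall of the generator.\<close>

definition functional :: "int \<Rightarrow> generator \<Rightarrow> (nat \<Rightarrow> int) \<Rightarrow> int" where
  "functional K s q = linear_part s q + (case s of Tm _ \<Rightarrow> K | _ \<Rightarrow> 0)"

text \<open>The entries of the Cartan matrix.\<close>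

definition cartan_entry :: "generator \<Rightarrow> generator \<Rightarrow> int" where
  "cartan_entry s r = linear_part s (direction r)"

lemma functional_shift:
  "functional K s (\<lambda>i. q i - a * direction r i) = functional K s q - a * cartan_entry s r"
  by (cases s) (auto simp: functional_def cartan_entry_def algebra_simps)

lemma cartan_entry_simps:
  "1 \<le> i \<Longrightarrow> 1 \<le> j \<Longrightarrow> cartan_entry (Sig i) (Sig j) =
     (if i = j then 2 else if i = Suc j \<or> j = Suc i then -1 else 0)"
  "1 \<le> j \<Longrightarrow> cartan_entry (Sig 0) (Sig j) = (if j = 1 then -1 else 0)"
  "1 \<le> i \<Longrightarrow> cartan_entry (Sig i) (Sig 0) = (if i = 1 then -2 else 0)"
  "i < m \<Longrightarrow> 2 \<le> m \<Longrightarrow> cartan_entry (Sig i) (Tm m) = (if Suc i = m then -2 else 0)"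
  "i < m \<Longrightarrow> 2 \<le> m \<Longrightarrow> cartan_entry (Tm m) (Sig i) = (if Suc i = m then -1 else 0)"
  "1 \<le> i \<Longrightarrow> cartan_entry Sigbar (Sig i) = (if i = 2 then -1 else 0)"
  "1 \<le> i \<Longrightarrow> cartan_entry (Sig i) Sigbar = (if i = 2 then -1 else 0)"
  "3 \<le> m \<Longrightarrow> cartan_entry Sigbar (Tm m) = 0" "3 \<le> m \<Longrightarrow> cartan_entry (Tm m) Sigbar = 0"
  by (simp_all add: cartan_entry_def)

lemma representation_C:
  assumes n: "2 \<le> n" and p: "0 < p 1" "\<And>i. 1 \<le> i \<Longrightarrow> i < n \<Longrightarrow> p i < p (Suc i)" "p n < K"
  shows "reflection_representation (gens_C n) (matrix_C n) (functional K) direction cartan_entry p"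
proof
  fix s r assume s: "s \<in> gens_C n"
  show "matrix_C n s s = 1" by simp
  show "cartan_entry s s = 2" using s n by (auto simp: gens_C_def cartan_entry_def)
  show "functional K s p > 0" using s n p by (auto simp: gens_C_def functional_def)
  assume r: "r \<in> gens_C n" and ne: "s \<noteq> r"
  show "(matrix_C n s r, cartan_entry s r, cartan_entry r s)
      \<in> {(2, 0, 0), (3, -1, -1), (4, -1, -2), (4, -2, -1)}"
  proof -
    have T: ?thesis if "s = Tm n" "r = Sig i" "i < n" for i
      using that n by (simp add: cartan_entry_simps matrix_sym(1)[of n "Tm n" "Sig i"] matrix_C_simps) arith
    have T': ?thesis if "r = Tm n" "s = Sig i" "i < n" for i
      using that n by (simp add: cartan_entry_simps matrix_C_simps) arith
    have ?thesis if "s = Sig i" "r = Sig j" "i < n" "j < n" for i j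
      using that ne n by (cases "i = 0"; cases "j = 0") (simp_all add: cartan_entry_simps matrix_C_simps)
    moreover have "s = Tm n \<or> (\<exists>i<n. s = Sig i)" "r = Tm n \<or> (\<exists>i<n. r = Sig i)"
      using s r n by (auto simp: gens_C_def)
    ultimately show ?thesis using T T' ne by blast
  qed
qed (rule functional_shift)

lemma representation_B:
  assumes n: "3 \<le> n" and p: "0 < p 1" "\<And>i. 1 \<le> i \<Longrightarrow> i < n \<Longrightarrow> p i < p (Suc i)" "p n < K"
  shows "reflection_representation (gens_B n) (matrix_B n) (functional K) direction cartan_entry p"
proof
  fix s r assume s: "s \<in> gens_B n"
  have "p 1 < p 2" using p(2)[of 1] n by (simp add: numeral_eq_Suc)
  then show "functional K s p > 0" using s n p by (auto simp: gens_B_def functional_def)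
  show "matrix_B n s s = 1" by simp
  show "cartan_entry s s = 2" using s n by (auto simp: gens_B_def cartan_entry_def)
  assume r: "r \<in> gens_B n" and ne: "s \<noteq> r"
  show "(matrix_B n s r, cartan_entry s r, cartan_entry r s)
      \<in> {(2, 0, 0), (3, -1, -1), (4, -1, -2), (4, -2, -1)}"
  proof -
    have T: ?thesis if "s = Tm n" "r = Sig i" "1 \<le> i" "i < n" for i
      using that n by (simp add: cartan_entry_simps matrix_sym(2)[of n "Tm n" "Sig i"] matrix_B_simps) arith
    have T': ?thesis if "r = Tm n" "s = Sig i" "1 \<le> i" "i < n" for i
      using that n by (simp add: cartan_entry_simps matrix_B_simps) arith
    have S: ?thesis if "s = Sig i" "r = Sig j" "1 \<le> i" "i < n" "1 \<le> j" "j < n" for i j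
      using that ne by (simp add: cartan_entry_simps matrix_B_simps)
    have B: ?thesis if "s = Sigbar" "r = Sig i" "1 \<le> i" for i
      using that by (simp add: cartan_entry_simps matrix_B_simps)
    have B': ?thesis if "r = Sigbar" "s = Sig i" "1 \<le> i" for i
      using that by (simp add: cartan_entry_simps matrix_B_simps)
    have TB: ?thesis if "s = Sigbar" "r = Tm n"
      using that n by (simp add: cartan_entry_simps matrix_B_simps)
    have TB': ?thesis if "r = Sigbar" "s = Tm n"
      using that n by (simp add: cartan_entry_simps matrix_sym(2)[of n "Tm n" Sigbar] matrix_B_simps)
    have "s = Tm n \<or> s = Sigbar \<or> (\<exists>i. 1 \<le> i \<and> i < n \<and> s = Sig i)"
      "r = Tm n \<or> r = Sigbar \<or> (\<exists>i. 1 \<le> i \<and> i < n \<and> r = Sig i)"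
      using s r n by (auto simp: gens_B_def)
    then show ?thesis using T T' S B B' TB TB' ne by blast
  qed
qed (rule functional_shift)


section \<open>Substitution for the last generator\<close>

text \<open>The action of the homomorphisms on letters and on words.\<close>

definition letter_image :: "nat \<Rightarrow> generator \<Rightarrow> generator list" where
  "letter_image n s = (if s = Tm n then [Sig n, Tm (n + 1), Sig n] else [s])"

definition word_image :: "nat \<Rightarrow> generator list \<Rightarrow> generator list" where
  "word_image n w = concat (map (letter_image n) w)"

lemma word_image_simps [simp]:
  "word_image n [] = []" "word_image n (s # w) = letter_image n s @ word_image n w"
  by (simp_all add: word_image_def)

lemma length_word_image: "length (word_image n w) = length w + 2 * count_list w (Tm n)"
  by (induction w) (auto simp: letter_image_def)

text \<open>
  The base point for \<open>K = 4 n + 2\<close>. The coordinates 1 to \<open>n\<close> are multiples of 4 and remain so under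
  the smaller group, because \<open>2 K\<close> is one as well. So none of them ever lies strictly between
  \<open>4 n\<close> and \<open>K\<close>, where the coordinate \<open>n + 1\<close> is placed.
\<close>

definition base_point :: "nat \<Rightarrow> nat \<Rightarrow> int" where
  "base_point n i = (if i \<le> n then 4 * int i else 4 * int n + 1)"

text \<open>
  The situation common to both families: \<open>S\<close> and \<open>S'\<close> are the generators in ranks \<open>n\<close> and \<open>n + 1\<close>,
  and \<open>h\<close> is the homomorphism between the two groups. Both groups act on the same points,
  with the same \<open>K\<close> and the same base point.
\<close>

locale stabilization =
  fixes n :: nat and S S' :: "generator set" and M M' :: "generator \<Rightarrow> generator \<Rightarrow> nat"
    and h :: "generator list set \<Rightarrow> generator list set"
  assumes n: "2 \<le> n"
    and S: "S \<subseteq> Sig ` {..<n} \<union> {Sigbar, Tm n}"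
    and S': "S - {Tm n} \<union> {Sig n, Tm (n + 1)} \<subseteq> S'"
    and rep: "reflection_representation S M (functional (4 * int n + 2)) direction cartan_entry (base_point n)"
    and rep': "reflection_representation S' M' (functional (4 * int n + 2)) direction cartan_entry (base_point n)"
    and hom: "h \<in> hom (coxeter_group S M) (coxeter_group S' M')"
    and h_gen: "s \<in> S \<Longrightarrow> h (coxeter_gen S M s) = coxeter_elt S' M' (letter_image n s)"
begin

sublocale A: reflection_representation S M "functional (4 * int n + 2)" direction cartan_entry "base_point n"
  by (rule rep)

sublocale B: reflection_representation S' M' "functional (4 * int n + 2)" direction cartan_entry "base_point n"
  by (rule rep')

lemma letter_image_closed: "s \<in> S \<Longrightarrow> letter_image n s \<in> lists S'"
  using S' by (auto simp: letter_image_def)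

lemma word_image_closed: "w \<in> lists S \<Longrightarrow> word_image n w \<in> lists S'"
  by (induction w) (use letter_image_closed in auto)

lemma h_coxeter_elt: "w \<in> lists S \<Longrightarrow> h (coxeter_elt S M w) = coxeter_elt S' M' (word_image n w)"
proof (induction w)
  case Nil
  interpret G: group "coxeter_group S M" using group_coxeter_group A.diag by blast
  interpret H: group "coxeter_group S' M'" using group_coxeter_group B.diag by blast
  show ?case using hom_one[OF hom G.group_axioms H.group_axioms] by (simp add: one_coxeter_group)
next
  case (Cons s w)
  have s: "s \<in> S" and w: "w \<in> lists S" and s': "[s] \<in> lists S" using Cons.prems by auto
  have "h (coxeter_elt S M (s # w)) =
      h (coxeter_gen S M s) \<otimes>\<^bsub>coxeter_group S' M'\<^esub> h (coxeter_elt S M w)"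
    using mult_coxeter_elt[OF s' w, of M] hom_mult[OF hom coxeter_elt_closed coxeter_elt_closed, OF s' w]
    by simp
  then show ?case
    using mult_coxeter_elt[OF letter_image_closed[OF s] word_image_closed[OF w]] Cons.IH[OF w] h_gen[OF s]
    by simp
qed

lemma count_word_image:
  "w \<in> lists S \<Longrightarrow> count_list (word_image n w) (Tm (n + 1)) = count_list w (Tm n)"
  by (induction w) (use S in \<open>auto simp: letter_image_def\<close>)

lemma foldr_letter_image: "foldr B.act (letter_image n s) q = A.act s q"
proof (cases "s = Tm n")
  case True
  show ?thesis
    unfolding True using n by (auto simp: letter_image_def A.act_def functional_def fun_eq_iff)
qed (simp add: letter_image_def)

lemma foldr_word_image: "foldr B.act (word_image n w) q = foldr A.act w q"
  by (induction w) (simp_all add: foldr_letter_image)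

lemma orbit_invariant:
  "w \<in> lists S \<Longrightarrow> (\<forall>i\<in>{1..n}. 4 dvd foldr A.act w (base_point n) i) \<and>
     foldr A.act w (base_point n) (n + 1) = 4 * int n + 1"
proof (induction w)
  case Nil
  show ?case by (simp add: base_point_def)
next
  case (Cons s w)
  define q where "q = foldr A.act w (base_point n)"
  have q: "4 dvd q i" if "1 \<le> i" "i \<le> n" for i using Cons that by (simp add: q_def)
  have q': "q (Suc n) = 4 * int n + 1" using Cons by (simp add: q_def)
  have "s \<in> Sig ` {..<n} \<union> {Sigbar, Tm n}" using Cons S by auto
  then have "(\<forall>i\<in>{1..n}. 4 dvd A.act s q i) \<and> A.act s q (Suc n) = 4 * int n + 1"
    using n q q' by (auto simp: A.act_def functional_def)
  then show ?case by (simp add: q_def)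
qed

lemma reduced_word_image: "reduced_word S M w \<Longrightarrow> reduced_word S' M' (word_image n w)"
proof (induction w)
  case Nil
  then show ?case by (simp add: reduced_word_def)
next
  case (Cons s w)
  let ?K = "4 * int n + 2"
  define q where "q = foldr A.act w (base_point n)"
  have w: "reduced_word S M w" and s: "s \<in> S" and wS: "w \<in> lists S"
    using Cons.prems reduced_word_Cons reduced_word_lists[OF Cons.prems] by auto
  have q: "foldr B.act (word_image n w) (base_point n) = q" by (simp add: q_def foldr_word_image)
  have red: "reduced_word S' M' (word_image n w)" using Cons.IH[OF w] .
  have pos: "functional ?K s q > 0" using A.reduced_Cons_positive[OF Cons.prems] by (simp add: q_def)
  show ?case
  proof (cases "s = Tm n")
    case False
    then have "s \<in> S'" using s S' by auto
    then show ?thesis using False B.reduced_Cons_iff[OF red] pos q by (simp add: letter_image_def)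
  next
    case True
    \<comment> \<open>Coordinates \<open>n\<close> and \<open>n + 1\<close> run from \<open>(x, 4 n + 1)\<close> through \<open>(4 n + 1, x)\<close> and
      \<open>(4 n + 1, 2 K - x)\<close> to \<open>(2 K - x, 4 n + 1)\<close>, where \<open>x \<le> 4 n\<close>.\<close>
    have S'n: "Sig n \<in> S'" "Tm (n + 1) \<in> S'" using S' by auto
    have "q n < ?K" using pos True by (simp add: functional_def)
    moreover have "4 dvd q n" "q (n + 1) = 4 * int n + 1"
      using orbit_invariant[OF wS] n by (auto simp: q_def)
    ultimately have qn: "q n \<le> 4 * int n" and q1: "q (Suc n) = 4 * int n + 1"
      by (presburger, simp)
    have 1: "reduced_word S' M' (Sig n # word_image n w)"
      using B.reduced_Cons_iff[OF red S'n(1)] q qn q1 n by (simp add: functional_def)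
    have 2: "reduced_word S' M' (Tm (n + 1) # Sig n # word_image n w)"
      using B.reduced_Cons_iff[OF 1 S'n(2)] q qn q1 n by (simp add: functional_def B.act_def)
    have "reduced_word S' M' (Sig n # Tm (n + 1) # Sig n # word_image n w)"
      using B.reduced_Cons_iff[OF 2 S'n(1)] q qn q1 n by (simp add: functional_def B.act_def)
    then show ?thesis using True by (simp add: letter_image_def)
  qed
qed

lemma length_h:
  assumes "reduced_word S M w"
  shows "coxeter_length S' M' (h (coxeter_elt S M w)) =
    coxeter_length S M (coxeter_elt S M w) + 2 * count_list w (Tm n)"
proof -
  have "reduced_expression S' M' (h (coxeter_elt S M w)) (word_image n w)"
    using reduced_word_image[OF assms] h_coxeter_elt[OF reduced_word_lists[OF assms]]
    by (simp add: reduced_expression_iff)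
  then show ?thesis
    by (simp add: reduced_expression_def length_word_image coxeter_length_eq[OF assms])
qed

text \<open>
  The number of letters \<open>Tm n\<close> is the same in all reduced words of an element, because by
  \<open>length_h\<close> the lengths of the element and of its image determine it.
\<close>

lemma occurrences_eq:
  assumes "reduced_word S M w"
  shows "occurrences S M (Tm n) (coxeter_elt S M w) = count_list w (Tm n)"
  unfolding occurrences_def
proof (rule the_equality)
  show "\<exists>u. reduced_expression S M (coxeter_elt S M w) u \<and> count_list u (Tm n) = count_list w (Tm n)"
    using assms by (auto simp: reduced_expression_iff)
  fix k assume "\<exists>u. reduced_expression S M (coxeter_elt S M w) u \<and> count_list u (Tm n) = k"
  then obtain u where "reduced_word S M u" "coxeter_elt S M u = coxeter_elt S M w" "count_list u (Tm n) = k"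
    by (auto simp: reduced_expression_iff)
  then show "k = count_list w (Tm n)" using length_h[OF assms] length_h[of u] by simp
qed

text \<open>
  The next homomorphism \<open>h'\<close>, from rank \<open>n + 1\<close> to rank \<open>n + 2\<close>, only serves to make the affine
  length well defined in rank \<open>n + 1\<close>.
\<close>

lemma stabilization_lengths:
  assumes "x \<in> carrier (coxeter_group S M)" and st: "stabilization (n + 1) S' S'' M' M'' h'"
  shows "coxeter_length S' M' (h x) = coxeter_length S M x + 2 * occurrences S M (Tm n) x"
    and "occurrences S' M' (Tm (n + 1)) (h x) = occurrences S M (Tm n) x"
proof -
  interpret N: stabilization "n + 1" S' S'' M' M'' h' by (rule st)
  obtain w0 where "w0 \<in> lists S" "x = coxeter_elt S M w0"
    using assms(1) unfolding carrier_coxeter_group by blast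
  then obtain w where w: "reduced_word S M w" "x = coxeter_elt S M w"
    using reduced_word_exists coxeter_elt_eq_iff coxeter_eq_lists by metis
  show "coxeter_length S' M' (h x) = coxeter_length S M x + 2 * occurrences S M (Tm n) x"
    using length_h occurrences_eq w by simp
  show "occurrences S' M' (Tm (n + 1)) (h x) = occurrences S M (Tm n) x"
    using N.occurrences_eq[OF reduced_word_image[OF w(1)]] occurrences_eq[OF w(1)]
      count_word_image h_coxeter_elt reduced_word_lists[OF w(1)] w(2) by simp
qed

end

lemma images_F_letter_image:
  assumes "2 \<le> n" "s \<in> gens_C n"
  shows "images_F n s = coxeter_elt (gens_C (n + 1)) (matrix_C (n + 1)) (letter_image n s)"
proof -
  have "Sig n \<in> gens_C (Suc n)" "Tm (Suc n) \<in> gens_C (Suc n)" by (auto simp: gens_C_def)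
  then show ?thesis
    by (auto simp: images_F_def letter_image_def gen_C_def W_C_def mult_coxeter_elt)
qed

lemma images_L_letter_image:
  assumes "3 \<le> n" "s \<in> gens_B n"
  shows "images_L n s = coxeter_elt (gens_B (n + 1)) (matrix_B (n + 1)) (letter_image n s)"
proof -
  have "Sig n \<in> gens_B (Suc n)" "Tm (Suc n) \<in> gens_B (Suc n)" using assms by (auto simp: gens_B_def)
  then show ?thesis
    by (auto simp: images_L_def letter_image_def gen_B_def W_B_def mult_coxeter_elt)
qed

lemma stabilization_C:
  assumes n: "2 \<le> n"
  shows "stabilization n (gens_C n) (gens_C (n + 1)) (matrix_C n) (matrix_C (n + 1)) (F_hom n)"
proof (rule stabilization.intro)
  show "2 \<le> n" by (rule n)
  show "gens_C n \<subseteq> Sig ` {..<n} \<union> {Sigbar, Tm n}" using n by (auto simp: gens_C_def)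
  show "gens_C n - {Tm n} \<union> {Sig n, Tm (n + 1)} \<subseteq> gens_C (n + 1)" by (auto simp: gens_C_def)
  show "reflection_representation (gens_C n) (matrix_C n) (functional (4 * int n + 2)) direction
      cartan_entry (base_point n)"
    by (rule representation_C[OF n]) (use n in \<open>auto simp: base_point_def\<close>)
  show "reflection_representation (gens_C (n + 1)) (matrix_C (n + 1)) (functional (4 * int n + 2))
      direction cartan_entry (base_point n)"
    by (rule representation_C) (use n in \<open>auto simp: base_point_def\<close>)
  show "F_hom n \<in> hom (coxeter_group (gens_C n) (matrix_C n))
      (coxeter_group (gens_C (n + 1)) (matrix_C (n + 1)))"
    using F_hom(1)[OF n] by (simp add: W_C_def)
  fix s assume "s \<in> gens_C n"
  then show "F_hom n (coxeter_gen (gens_C n) (matrix_C n) s) =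
      coxeter_elt (gens_C (n + 1)) (matrix_C (n + 1)) (letter_image n s)"
    using F_hom(2)[OF n] images_F_letter_image[OF n] by (simp add: gen_C_def)
qed

lemma stabilization_B:
  assumes n: "3 \<le> n"
  shows "stabilization n (gens_B n) (gens_B (n + 1)) (matrix_B n) (matrix_B (n + 1)) (L_hom n)"
proof (rule stabilization.intro)
  show "2 \<le> n" using n by simp
  show "gens_B n \<subseteq> Sig ` {..<n} \<union> {Sigbar, Tm n}" using n by (auto simp: gens_B_def)
  show "gens_B n - {Tm n} \<union> {Sig n, Tm (n + 1)} \<subseteq> gens_B (n + 1)"
    using n by (auto simp: gens_B_def)
  show "reflection_representation (gens_B n) (matrix_B n) (functional (4 * int n + 2)) direction
      cartan_entry (base_point n)"
    by (rule representation_B[OF n]) (use n in \<open>auto simp: base_point_def\<close>)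
  show "reflection_representation (gens_B (n + 1)) (matrix_B (n + 1)) (functional (4 * int n + 2))
      direction cartan_entry (base_point n)"
    by (rule representation_B) (use n in \<open>auto simp: base_point_def\<close>)
  show "L_hom n \<in> hom (coxeter_group (gens_B n) (matrix_B n))
      (coxeter_group (gens_B (n + 1)) (matrix_B (n + 1)))"
    using L_hom(1)[OF n] by (simp add: W_B_def)
  fix s assume "s \<in> gens_B n"
  then show "L_hom n (coxeter_gen (gens_B n) (matrix_B n) s) =
      coxeter_elt (gens_B (n + 1)) (matrix_B (n + 1)) (letter_image n s)"
    using L_hom(2)[OF n] images_L_letter_image[OF n] by (simp add: gen_B_def)
qed

theorem corollary2p7:
  shows "(\<forall>n\<ge>2. \<forall>v\<in>carrier (W_C n).
            length_C (n + 1) (F_hom n v) = length_C n v + 2 * affine_length_C n v \<and>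
            affine_length_C (n + 1) (F_hom n v) = affine_length_C n v) \<and>
         (\<forall>n\<ge>3. \<forall>w\<in>carrier (W_B n).
            length_B (n + 1) (L_hom n w) = length_B n w + 2 * affine_length_B n w \<and>
            affine_length_B (n + 1) (L_hom n w) = affine_length_B n w)"
proof (intro conjI allI impI ballI)
  fix n v assume n: "2 \<le> n" and v: "v \<in> carrier (W_C n)"
  have "stabilization (n + 1) (gens_C (n + 1)) (gens_C (n + 1 + 1)) (matrix_C (n + 1))
      (matrix_C (n + 1 + 1)) (F_hom (n + 1))"
    using n by (intro stabilization_C) simp
  from stabilization.stabilization_lengths[OF stabilization_C[OF n] v[unfolded W_C_def] this]
  show "length_C (n + 1) (F_hom n v) = length_C n v + 2 * affine_length_C n v"
    and "affine_length_C (n + 1) (F_hom n v) = affine_length_C n v"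
    by (simp_all add: length_C_def affine_length_C_def)
next
  fix n w assume n: "3 \<le> n" and w: "w \<in> carrier (W_B n)"
  have "stabilization (n + 1) (gens_B (n + 1)) (gens_B (n + 1 + 1)) (matrix_B (n + 1))
      (matrix_B (n + 1 + 1)) (L_hom (n + 1))"
    using n by (intro stabilization_B) simp
  from stabilization.stabilization_lengths[OF stabilization_B[OF n] w[unfolded W_B_def] this]
  show "length_B (n + 1) (L_hom n w) = length_B n w + 2 * affine_length_B n w"
    and "affine_length_B (n + 1) (L_hom n w) = affine_length_B n w"
    by (simp_all add: length_B_def affine_length_B_def)
qed

end
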